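(* Let $R$ be a von Neumann regular unital ring and let $\mathscr G(X,P)$ be the Deaconu-Renault groupoid of a directed right action of a cancellative left reversible monoid $P$ on a locally compact, Hausdorff and totally disconnected space $X$ by partial local homeomorphisms. Assume that the domain $U_p$ of the action of $p$ is clopen in $X$ for all $p\in P$. Then $R\mathscr G(X,P)$ is graded regular with respect to the $G$-grading coming from the canonical cocycle $c\colon\mathscr G(X,P)\to G$, $c(x,g,y)=g$, where $G$ is the group of fractions of $P$.
   Context: A ring is von Neumann regular if for every $a$ there is $b$ with $aba=a$; a $G$-graded ring is graded regular if for every homogeneous $x$ there is $y$ in the ring with $xyx=x$. Monoids: $P$ (identity $e$) is left reversible if $aP\cap bP\neq\emptyset$ for all $a,b\in P$. A cancellative left reversible monoid embeds in its group of fractions $G$, and $G=\{pq^{-1}\mid p,q\in P\}$. Actions: a right action of $P$ on $X$ by partial local homeomorphisms is a partially defined map $X\times P\to X$, $(x,p)\mapsto xp$, such that, with $U_p=\{x\in X\mid xp\text{ is defined}\}$ and $V_p=\{xp\mid x\in U_p\}$, the sets $U_p,V_p$ are open and: (1) $x\mapsto xp$ is a local homeomorphism $U_p\to V_p$ for all $p$; (2) $U_e=X$ and $xe=x$ for all $x$; (3) $x\in U_{pq}$ iff $x\in U_p$ and $xp\in U_q$, in which case $(xp)q=x(pq)$. The action is directed if for all $p,q\in P$ with $U_p\cap U_q\ne\emptyset$ there is $r\in pP\cap qP$ with $U_r=U_p\cap U_q$. Groupoid: $\mathscr G(X,P)=\{(x,g,y)\in X\times G\times X\mid \exists p,q\in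 P,\ xp=yq,\ g=pq^{-1}\}$ (where $xp=yq$ includes that both sides are defined). The pair $(x,g,y),(x',g',y')$ is composable iff $y=x'$, and then the product is $(x,gg',y')$; the inverse is $(x,g,y)^{-1}=(y,g^{-1},x)$. A basis for the topology is given by the sets $D(U,p,q,V)=\{(x,pq^{-1},y)\mid x\in U,\ y\in V,\ xp=yq\}$ with $U,V\subseteq X$ open and $p,q\in P$. With this topology $\mathscr G(X,P)$ is a Hausdorff ample groupoid with unit space identified with $X$, and $c$ is a continuous cocycle. Algebra: for an ample groupoid $\mathscr G$ (étale with unit space having a basis of compact open sets), $R\mathscr G$ is the left $R$-submodule of $R^{\mathscr G}$ spanned by characteristic functions $1_U$ of compact open bisections $U$ (compact open sets on which source and range restrict to homeomorphisms onto open subsets of the unit space), with product $f*g(\gamma)=\sum_{\alpha\beta=\gamma}f(\alpha)g(\beta)$. The $G$-grading induced by $c$ has degree-$g$ component the $R$-span of the $1_U$ with $U$ a compact open bisection contained in $c^{-1}(g)$. *)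

theory Defs
  imports "HOL-Analysis.Analysis" "HOL-Algebra.Coset" "HOL-Algebra.Divisibility"
begin

section \<open>Von Neumann regularity\<close>

text \<open>The sort \<open>{ring, monoid_mult}\<close>, used instead of \<open>ring_1\<close>, is that of unital, not
  necessarily commutative rings in which \<open>0 = 1\<close> is allowed.\<close>

definition von_neumann_regular :: "'r::{ring, monoid_mult} itself \<Rightarrow> bool" where
  "von_neumann_regular _ \<longleftrightarrow> (\<forall>a::'r. \<exists>b::'r. a * b * a = a)"

text \<open>The ring is given by its carrier \<open>A\<close> and its multiplication \<open>m\<close>, since the
  algebras below need not have a unit (which the ring records of HOL-Algebra require);
  \<open>H g\<close> is the homogeneous component of degree \<open>g \<in> I\<close>.\<close>

definition graded_regular ::
  "'g set \<Rightarrow> 'b set \<Rightarrow> ('b \<Rightarrow> 'b \<Rightarrow> 'b) \<Rightarrow> ('g \<Rightarrow> 'b set) \<Rightarrow> bool" where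
  "graded_regular I A m H \<longleftrightarrow> (\<forall>g\<in>I. \<forall>a\<in>H g. \<exists>b\<in>A. m (m a b) a = a)"


section \<open>Monoids and groups of fractions\<close>

definition left_reversible :: "('p, 'm) monoid_scheme \<Rightarrow> bool" where
  "left_reversible P \<longleftrightarrow>
     (\<forall>a\<in>carrier P. \<forall>b\<in>carrier P.
        (a <#\<^bsub>P\<^esub> carrier P) \<inter> (b <#\<^bsub>P\<^esub> carrier P) \<noteq> {})"

text \<open>\<open>G\<close> is a group of (right) fractions of \<open>P\<close> with canonical embedding \<open>\<iota>\<close>; for cancellative
  left reversible \<open>P\<close> these conditions determine \<open>(G, \<iota>)\<close> up to unique isomorphism.\<close>

definition group_of_fractions ::
  "('p, 'm) monoid_scheme \<Rightarrow> ('g, 'n) monoid_scheme \<Rightarrow> ('p \<Rightarrow> 'g) \<Rightarrow> bool" where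
  "group_of_fractions P G \<iota> \<longleftrightarrow>
     group G \<and> \<iota> \<in> hom P G \<and> inj_on \<iota> (carrier P) \<and>
     carrier G = {\<iota> p \<otimes>\<^bsub>G\<^esub> inv\<^bsub>G\<^esub> (\<iota> q) | p q. p \<in> carrier P \<and> q \<in> carrier P}"


section \<open>Topology\<close>

definition totally_disconnected_space :: "'a topology \<Rightarrow> bool" where
  "totally_disconnected_space X \<longleftrightarrow> (\<forall>S. connectedin X S \<longrightarrow> (\<exists>a. S \<subseteq> {a}))"

definition restricts_to_homeo :: "'a topology \<Rightarrow> 'b topology \<Rightarrow> ('a \<Rightarrow> 'b) \<Rightarrow> 'a set \<Rightarrow> bool" where
  "restricts_to_homeo X Y f W \<longleftrightarrow>
     openin Y (f ` W) \<and> homeomorphic_map (subtopology X W) (subtopology Y (f ` W)) f"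

definition local_homeo :: "'a topology \<Rightarrow> 'b topology \<Rightarrow> ('a \<Rightarrow> 'b) \<Rightarrow> bool" where
  "local_homeo X Y f \<longleftrightarrow>
     (\<forall>x\<in>topspace X. \<exists>W. openin X W \<and> x \<in> W \<and> restricts_to_homeo X Y f W)"


section \<open>Partial actions by local homeomorphisms\<close>

text \<open>\<open>act x p = None\<close> means that \<open>xp\<close> is undefined.\<close>

definition act_dom :: "'x topology \<Rightarrow> ('x \<Rightarrow> 'p \<Rightarrow> 'x option) \<Rightarrow> 'p \<Rightarrow> 'x set" where
  "act_dom X act p = {x \<in> topspace X. act x p \<noteq> None}"

definition act_ran :: "'x topology \<Rightarrow> ('x \<Rightarrow> 'p \<Rightarrow> 'x option) \<Rightarrow> 'p \<Rightarrow> 'x set" where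
  "act_ran X act p = (\<lambda>x. the (act x p)) ` act_dom X act p"

locale partial_local_homeo_action = monoid P
  for X :: "'x topology" and P :: "('p, 'm) monoid_scheme" (structure)
    and act :: "'x \<Rightarrow> 'p \<Rightarrow> 'x option" +
  assumes dom_open: "p \<in> carrier P \<Longrightarrow> openin X (act_dom X act p)"
    and ran_open: "p \<in> carrier P \<Longrightarrow> openin X (act_ran X act p)"
    and act_local_homeo: "p \<in> carrier P \<Longrightarrow>
      local_homeo (subtopology X (act_dom X act p)) (subtopology X (act_ran X act p))
        (\<lambda>x. the (act x p))"
    and act_one: "x \<in> topspace X \<Longrightarrow> act x \<one> = Some x"
    and dom_mult: "\<lbrakk>p \<in> carrier P; q \<in> carrier P\<rbrakk> \<Longrightarrow>
      x \<in> act_dom X act (p \<otimes> q) \<longleftrightarrow>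
      x \<in> act_dom X act p \<and> the (act x p) \<in> act_dom X act q"
    and act_mult: "\<lbrakk>p \<in> carrier P; q \<in> carrier P; x \<in> act_dom X act (p \<otimes> q)\<rbrakk> \<Longrightarrow>
      act (the (act x p)) q = act x (p \<otimes> q)"

definition directed_action ::
  "'x topology \<Rightarrow> ('p, 'm) monoid_scheme \<Rightarrow> ('x \<Rightarrow> 'p \<Rightarrow> 'x option) \<Rightarrow> bool" where
  "directed_action X P act \<longleftrightarrow>
     (\<forall>p\<in>carrier P. \<forall>q\<in>carrier P. act_dom X act p \<inter> act_dom X act q \<noteq> {} \<longrightarrow>
        (\<exists>r \<in> (p <#\<^bsub>P\<^esub> carrier P) \<inter> (q <#\<^bsub>P\<^esub> carrier P).
           act_dom X act r = act_dom X act p \<inter> act_dom X act q))"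


section \<open>Groupoids and their convolution algebras\<close>

text \<open>The data of a topological groupoid. Its set of arrows is the \<open>topspace\<close> of \<open>gtop\<close>.\<close>

record 'a groupoid =
  gtop :: "'a topology"
  gcomposable :: "'a \<Rightarrow> 'a \<Rightarrow> bool"
  gmult :: "'a \<Rightarrow> 'a \<Rightarrow> 'a"
  ginv :: "'a \<Rightarrow> 'a"

definition gsource :: "'a groupoid \<Rightarrow> 'a \<Rightarrow> 'a" where
  "gsource \<G> \<gamma> = gmult \<G> (ginv \<G> \<gamma>) \<gamma>"

definition grange :: "'a groupoid \<Rightarrow> 'a \<Rightarrow> 'a" where
  "grange \<G> \<gamma> = gmult \<G> \<gamma> (ginv \<G> \<gamma>)"

definition gunits :: "'a groupoid \<Rightarrow> 'a topology" where
  "gunits \<G> = subtopology (gtop \<G>) (gsource \<G> ` topspace (gtop \<G>))"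

definition compact_open_bisection :: "'a groupoid \<Rightarrow> 'a set \<Rightarrow> bool" where
  "compact_open_bisection \<G> U \<longleftrightarrow>
     compactin (gtop \<G>) U \<and> openin (gtop \<G>) U \<and>
     restricts_to_homeo (gtop \<G>) (gunits \<G>) (gsource \<G>) U \<and>
     restricts_to_homeo (gtop \<G>) (gunits \<G>) (grange \<G>) U"

text \<open>\<open>indicator\<close> from the library would exclude the zero ring.\<close>

definition char_fun :: "'a set \<Rightarrow> 'a \<Rightarrow> 'r::{ring, monoid_mult}" where
  "char_fun U = (\<lambda>\<gamma>. if \<gamma> \<in> U then 1 else 0)"

text \<open>Left linear span over a not necessarily commutative ring.\<close>

definition left_span :: "('a \<Rightarrow> 'r::{ring, monoid_mult}) set \<Rightarrow> ('a \<Rightarrow> 'r) set" where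
  "left_span B = {\<lambda>\<gamma>. \<Sum>b\<in>S. c b * b \<gamma> | S c. finite S \<and> S \<subseteq> B}"

text \<open>Functions on the groupoid are represented by functions on the ambient type that
  vanish outside the set of arrows.\<close>

definition groupoid_algebra :: "'a groupoid \<Rightarrow> ('a \<Rightarrow> 'r::{ring, monoid_mult}) set" where
  "groupoid_algebra \<G> = left_span {char_fun U | U. compact_open_bisection \<G> U}"

text \<open>The index set is restricted to the factorizations on which both functions are nonzero:
  there may be infinitely many factorizations of \<open>\<gamma>\<close>, but only finitely many of these
  for functions in the algebra, whereas \<open>sum\<close> over an infinite set is \<open>0\<close>.\<close>

definition convolution ::
  "'a groupoid \<Rightarrow> ('a \<Rightarrow> 'r::{ring, monoid_mult}) \<Rightarrow> ('a \<Rightarrow> 'r) \<Rightarrow> 'a \<Rightarrow> 'r" where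
  "convolution \<G> f g = (\<lambda>\<gamma>.
     \<Sum>(\<alpha>, \<beta>) \<in> {(\<alpha>, \<beta>). \<alpha> \<in> topspace (gtop \<G>) \<and> \<beta> \<in> topspace (gtop \<G>) \<and>
         gcomposable \<G> \<alpha> \<beta> \<and> gmult \<G> \<alpha> \<beta> = \<gamma> \<and> f \<alpha> \<noteq> 0 \<and> g \<beta> \<noteq> 0}.
       f \<alpha> * g \<beta>)"

definition cocycle_component ::
  "'a groupoid \<Rightarrow> ('a \<Rightarrow> 'g) \<Rightarrow> 'g \<Rightarrow> ('a \<Rightarrow> 'r::{ring, monoid_mult}) set" where
  "cocycle_component \<G> c g =
     left_span {char_fun U | U. compact_open_bisection \<G> U \<and> U \<subseteq> c -` {g}}"


section \<open>Deaconu--Renault groupoids\<close>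

definition dr_arrows ::
  "'x topology \<Rightarrow> ('p, 'm) monoid_scheme \<Rightarrow> ('x \<Rightarrow> 'p \<Rightarrow> 'x option) \<Rightarrow>
   ('g, 'n) monoid_scheme \<Rightarrow> ('p \<Rightarrow> 'g) \<Rightarrow> 'x set \<Rightarrow> 'p \<Rightarrow> 'p \<Rightarrow> 'x set \<Rightarrow> ('x \<times> 'g \<times> 'x) set" where
  "dr_arrows X P act G \<iota> U p q V =
     {(x, \<iota> p \<otimes>\<^bsub>G\<^esub> inv\<^bsub>G\<^esub> (\<iota> q), y) | x y.
        x \<in> U \<and> y \<in> V \<and> x \<in> act_dom X act p \<and> y \<in> act_dom X act q \<and> act x p = act y q}"

text \<open>The basic open sets \<open>D(U,p,q,V)\<close>, which by definition cover the set of arrows (take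
  \<open>U = V = topspace X\<close>). As they form a basis for a directed action, the topology they
  generate as a subbasis is the one having them as a basis.\<close>

definition dr_topology ::
  "'x topology \<Rightarrow> ('p, 'm) monoid_scheme \<Rightarrow> ('x \<Rightarrow> 'p \<Rightarrow> 'x option) \<Rightarrow>
   ('g, 'n) monoid_scheme \<Rightarrow> ('p \<Rightarrow> 'g) \<Rightarrow> ('x \<times> 'g \<times> 'x) topology" where
  "dr_topology X P act G \<iota> =
     topology_generated_by
       {dr_arrows X P act G \<iota> U p q V | U p q V.
          openin X U \<and> openin X V \<and> p \<in> carrier P \<and> q \<in> carrier P}"

definition dr_groupoid ::
  "'x topology \<Rightarrow> ('p, 'm) monoid_scheme \<Rightarrow> ('x \<Rightarrow> 'p \<Rightarrow> 'x option) \<Rightarrow>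
   ('g, 'n) monoid_scheme \<Rightarrow> ('p \<Rightarrow> 'g) \<Rightarrow> ('x \<times> 'g \<times> 'x) groupoid" where
  "dr_groupoid X P act G \<iota> =
     \<lparr> gtop = dr_topology X P act G \<iota>,
       gcomposable = (\<lambda>(x, g, y) (x', g', y'). y = x'),
       gmult = (\<lambda>(x, g, y) (x', g', y'). (x, g \<otimes>\<^bsub>G\<^esub> g', y')),
       ginv = (\<lambda>(x, g, y). (y, inv\<^bsub>G\<^esub> g, x)) \<rparr>"

text \<open>The set of arrows is the set of triples \<open>(x, g, y)\<close> of the definition.\<close>

lemma topspace_dr_groupoid:
  "topspace (gtop (dr_groupoid X P act G \<iota>)) =
     {(x, g, y). x \<in> topspace X \<and> y \<in> topspace X \<and>
        (\<exists>p\<in>carrier P. \<exists>q\<in>carrier P. act x p \<noteq> None \<and> act y q \<noteq> None \<and> act x p = act y q \<and>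
           g = \<iota> p \<otimes>\<^bsub>G\<^esub> inv\<^bsub>G\<^esub> (\<iota> q))}"
  (is "?L = ?R")
proof
  show "?L \<subseteq> ?R"
    unfolding dr_groupoid_def dr_topology_def groupoid.simps topology_generated_by_topspace
    by (clarsimp simp: dr_arrows_def act_dom_def) (metis option.distinct(1))
  show "?R \<subseteq> ?L"
  proof
    fix \<gamma> assume "\<gamma> \<in> ?R"
    then obtain p q where "p \<in> carrier P" "q \<in> carrier P"
      and "\<gamma> \<in> dr_arrows X P act G \<iota> (topspace X) p q (topspace X)"
      by (force simp: dr_arrows_def act_dom_def)
    then show "\<gamma> \<in> ?L"
      unfolding dr_groupoid_def dr_topology_def groupoid.simps topology_generated_by_topspace
      by blast
  qed
qed

definition dr_cocycle :: "'x \<times> 'g \<times> 'x \<Rightarrow> 'g" where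
  "dr_cocycle = (\<lambda>(x, g, y). g)"

end

theory Submission
  imports Defs
begin

text \<open>A homogeneous element of degree \<open>g\<close> has compact support, which is described by finitely
  many pairs \<open>(p, q)\<close> of degree \<open>g\<close>. Clopenness of the domains splits \<open>X\<close> into finitely many
  clopen pieces according to which of these elements act, and directedness provides on each piece
  a single pair \<open>(r, t)\<close> describing the support there: all its arrows \<open>(x, g, y)\<close> satisfy \<open>xr = yt\<close>.
  Cutting the two projections of the support into finitely many disjoint compact open cells on
  which the actions of \<open>r\<close> and \<open>t\<close> are injective turns the element into a locally constant function
  of \<open>z = xr = yt\<close> with values in matrices of bounded size over the ring. Matrices of this kind are von
  Neumann regular, and a choice of quasi-inverses of the finitely many matrices that occur is a
  locally constant quasi-inverse of the element.\<close>

subsection \<open>Matrices over von Neumann regular rings\<close>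

definition mat_mult :: "'j set \<Rightarrow> ('i \<Rightarrow> 'j \<Rightarrow> 'r) \<Rightarrow> ('j \<Rightarrow> 'k \<Rightarrow> 'r) \<Rightarrow> 'i \<Rightarrow> 'k \<Rightarrow> 'r::ring" where
  "mat_mult J A B = (\<lambda>i k. \<Sum>j\<in>J. A i j * B j k)"

lemma mat_mult_assoc:
  "mat_mult K (mat_mult J A B) C = mat_mult J A (mat_mult K B C)"
  unfolding mat_mult_def
  by (intro ext) (simp add: sum_distrib_left sum_distrib_right mult.assoc, rule sum.swap)

lemma mat_mult_diff_left:
  "mat_mult J (\<lambda>i j. A i j - A' i j) B = (\<lambda>i k. mat_mult J A B i k - mat_mult J A' B i k)"
  unfolding mat_mult_def by (intro ext) (simp add: left_diff_distrib sum_subtractf)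

lemma mat_mult_diff_right:
  "mat_mult J A (\<lambda>j k. B j k - B' j k) = (\<lambda>i k. mat_mult J A B i k - mat_mult J A B' i k)"
  unfolding mat_mult_def by (intro ext) (simp add: right_diff_distrib sum_subtractf)

lemma mat_mult_add_left:
  "mat_mult J (\<lambda>i j. A i j + A' i j) B = (\<lambda>i k. mat_mult J A B i k + mat_mult J A' B i k)"
  unfolding mat_mult_def by (intro ext) (simp add: distrib_right sum.distrib)

lemma mat_mult_add_right:
  "mat_mult J A (\<lambda>j k. B j k + B' j k) = (\<lambda>i k. mat_mult J A B i k + mat_mult J A B' i k)"
  unfolding mat_mult_def by (intro ext) (simp add: distrib_left sum.distrib)

definition mat_regular :: "'i set \<Rightarrow> 'j set \<Rightarrow> ('i \<Rightarrow> 'j \<Rightarrow> 'r::ring) \<Rightarrow> bool" where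
  "mat_regular I J A \<longleftrightarrow>
     (\<exists>B. \<forall>i\<in>I. \<forall>j\<in>J. mat_mult I (mat_mult J A B) A i j = A i j)"

lemma mat_regular_if_diff:
  fixes A :: "'i \<Rightarrow> 'j \<Rightarrow> 'r::ring"
  assumes "mat_regular I J (\<lambda>i j. A i j - mat_mult I (mat_mult J A C) A i j)"
  shows "mat_regular I J A"
proof -
  let ?m = "mat_mult I" and ?n = "mat_mult J"
  let ?A' = "\<lambda>i j. A i j - ?m (?n A C) A i j"
  obtain D where D: "\<And>i j. i \<in> I \<Longrightarrow> j \<in> J \<Longrightarrow> ?m (?n ?A' D) ?A' i j = ?A' i j"
    using assms unfolding mat_regular_def by blast
  let ?CA = "?m C A" and ?AC = "?n A C"
  let ?B = "\<lambda>j i. C j i + D j i - ?n ?CA D j i - ?m D ?AC j i + ?m (?n ?CA D) ?AC j i"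
  have "?m (?n A ?B) A i j = A i j" if "i \<in> I" "j \<in> J" for i j
    using D[OF that]
    by (simp add: mat_mult_diff_left mat_mult_diff_right mat_mult_add_left mat_mult_add_right
        mat_mult_assoc algebra_simps)
  then show ?thesis
    unfolding mat_regular_def by blast
qed

lemma mat_regular_of_von_neumann_regular:
  fixes A :: "'i \<Rightarrow> 'j \<Rightarrow> 'r::{ring, monoid_mult}"
  assumes vN: "von_neumann_regular TYPE('r)" and I: "finite I" and J: "finite J"
  shows "mat_regular I J A"
proof -
  have "mat_regular I J A"
    if "finite R" "R \<subseteq> I" "\<And>i j. i \<in> I - R \<Longrightarrow> j \<in> J \<Longrightarrow> A i j = 0" for R and A :: "'i \<Rightarrow> 'j \<Rightarrow> 'r"
    using that
  proof (induction R arbitrary: A rule: finite_induct)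
    case empty
    then have "mat_mult I (mat_mult J A (\<lambda>_ _. 0)) A i j = A i j" if "i \<in> I" "j \<in> J" for i j
      using that by (simp add: mat_mult_def)
    then show ?case
      unfolding mat_regular_def by blast
  next
    case (insert r R)
    note outer_IH = insert.IH and outer_prems = insert.prems
    have "mat_regular I J B"
      if "finite S" "S \<subseteq> J" "\<And>i j. i \<in> I - insert r R \<Longrightarrow> j \<in> J \<Longrightarrow> B i j = 0"
        "\<And>j. j \<in> J - S \<Longrightarrow> B r j = 0" for S and B :: "'i \<Rightarrow> 'j \<Rightarrow> 'r"
      using that
    proof (induction S arbitrary: B rule: finite_induct)
      case empty
      show ?case
      proof (rule outer_IH)
        fix i j assume "i \<in> I - R" "j \<in> J"
        then show "B i j = 0"
          using empty.prems by (cases "i = r") auto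
      qed (use outer_prems in auto)
    next
      case (insert s S)
      obtain b where b: "B r s * b * B r s = B r s"
        using vN unfolding von_neumann_regular_def by blast
      let ?C = "\<lambda>j i. if j = s \<and> i = r then b else 0"
      have "mat_mult J B ?C i k = (if k = r then B i s * b else 0)" for i k
        using insert.prems J by (simp add: mat_mult_def if_distrib[of "(*) _"] sum.delta cong: if_cong)
      then have BCB: "mat_mult I (mat_mult J B ?C) B i j = B i s * b * B r j" for i j
        using outer_prems I
        by (simp add: mat_mult_def[of I] if_distrib[of "\<lambda>x. x * _"] sum.delta cong: if_cong)
      show ?case
      proof (rule mat_regular_if_diff[where C = ?C], rule insert.IH, goal_cases)
        case (3 j)
        then show ?case
          using insert.prems b by (cases "j = s") (auto simp: BCB)
      qed (use insert.prems in \<open>auto simp: BCB\<close>)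
    qed
    from this[of J A] J outer_prems show ?case
      by auto
  qed
  from this[of I A] I show ?thesis
    by simp
qed

subsection \<open>Fibres, compact open sets and spans\<close>

lemma sum_fibre_eq_sum_cells:
  fixes f :: "'y \<Rightarrow> 'r::comm_monoid_add"
  assumes fin: "finite \<Y>" and dis: "pairwise disjnt \<Y>"
    and inj: "\<And>Y. Y \<in> \<Y> \<Longrightarrow> inj_on \<psi> Y"
    and S: "S \<subseteq> {y \<in> \<Union>\<Y>. \<psi> y = z}"
    and h1: "\<And>Y y. Y \<in> \<Y> \<Longrightarrow> y \<in> Y \<Longrightarrow> \<psi> y = z \<Longrightarrow> h Y = (if y \<in> S then f y else 0)"
    and h0: "\<And>Y. Y \<in> \<Y> \<Longrightarrow> z \<notin> \<psi> ` Y \<Longrightarrow> h Y = 0"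
  shows "sum f S = sum h \<Y>"
proof -
  define c where "c y = (THE Y. Y \<in> \<Y> \<and> y \<in> Y)" for y
  have c: "c y = Y" if "Y \<in> \<Y>" "y \<in> Y" for y Y
    unfolding c_def using that dis
    by (intro the_equality) (auto simp: pairwise_def disjnt_iff)
  have cS: "c y \<in> \<Y> \<and> y \<in> c y \<and> \<psi> y = z" if "y \<in> S" for y
    using that S c by fastforce
  have "inj_on c S"
  proof (rule inj_onI)
    fix y y' assume "y \<in> S" "y' \<in> S" "c y = c y'"
    with cS[of y] cS[of y'] inj[of "c y"] show "y = y'"
      by (metis inj_onD)
  qed
  then have "sum h (c ` S) = sum (\<lambda>y. h (c y)) S"
    by (simp add: sum.reindex)
  also have "\<dots> = sum f S"
  proof (rule sum.cong[OF refl])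
    fix y assume "y \<in> S"
    then show "h (c y) = f y"
      using h1[of "c y" y] cS[of y] by simp
  qed
  finally have "sum f S = sum h (c ` S)" ..
  also have "\<dots> = sum h \<Y>"
  proof (rule sum.mono_neutral_left[OF fin])
    show "\<forall>Y\<in>\<Y> - c ` S. h Y = 0"
    proof
      fix Y assume Y: "Y \<in> \<Y> - c ` S"
      show "h Y = 0"
      proof (cases "z \<in> \<psi> ` Y")
        case True
        then obtain y where "y \<in> Y" "\<psi> y = z"
          by auto
        moreover have "y \<notin> S"
          using Y c \<open>y \<in> Y\<close> by auto
        ultimately show ?thesis
          using h1 Y by auto
      qed (use h0 Y in auto)
    qed
  qed (use cS in auto)
  finally show ?thesis .
qed

lemma compact_open_neighbourhood:
  assumes lc: "locally_compact_space X" and H: "Hausdorff_space X"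
    and td: "totally_disconnected_space X" and W: "openin X W" "x \<in> W"
  obtains U where "compactin X U" "openin X U" "x \<in> U" "U \<subseteq> W"
proof -
  have x: "x \<in> topspace X"
    using W openin_subset by blast
  have "neighbourhood_base_of (\<lambda>C. compactin X C \<and> closedin X C) X"
    using lc H locally_compact_space_neighbourhood_base_closedin by blast
  then obtain V K where VK: "openin X V" "compactin X K" "x \<in> V" "V \<subseteq> K" "K \<subseteq> W"
    using W x unfolding neighbourhood_base_of_def neighbourhood_base_at_def by metis
  obtain a where "connected_component_of_set X x \<subseteq> {a}"
    using td connectedin_connected_component_of unfolding totally_disconnected_space_def by metis
  then have "connected_component_of_set X x = {x}"
    using x connected_component_of_refl[of X x] by blast
  then have "{x} \<in> connected_components_of X"
    using x connected_component_in_connected_components_of by metis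
  then obtain U U' where U: "openin X U" "openin X U'" "disjnt U U'" "U \<union> U' = topspace X"
      "{x} \<subseteq> U" "U \<subseteq> V"
    using wilder_locally_compact_component_thm[OF lc H, of "{x}" V] VK x by auto
  have "U = topspace X - U'"
    using U by (auto simp: disjnt_iff)
  then have "closedin X U"
    using U by auto
  then have "compactin X U"
    using closed_compactin[OF VK(2)] U VK by blast
  with that U VK show thesis
    by blast
qed

lemma compact_open_Diff:
  assumes "Hausdorff_space X" "compactin X U" "openin X U" "compactin X V" "openin X V"
  shows "compactin X (U - V)" "openin X (U - V)"
proof -
  show "openin X (U - V)"
    using assms compactin_imp_closedin openin_diff by blast
  have "compactin X (U \<inter> (topspace X - V))"
    using assms by (intro compact_Int_closedin) auto
  then show "compactin X (U - V)"
    using assms openin_subset by (metis Diff_Int2 Diff_Int_distrib2 inf.absorb2 inf_commute)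
qed

lemma disjoint_compact_open_cover:
  assumes lc: "locally_compact_space X" and H: "Hausdorff_space X"
    and td: "totally_disconnected_space X" and C: "compactin X C"
    and nbhd: "\<And>x. x \<in> C \<Longrightarrow> \<exists>W. openin X W \<and> x \<in> W \<and> Q W"
    and hereditary: "\<And>V W. Q W \<Longrightarrow> V \<subseteq> W \<Longrightarrow> Q V"
  obtains \<W> where "finite \<W>" "pairwise disjnt \<W>" "C \<subseteq> \<Union>\<W>"
    "\<forall>W\<in>\<W>. compactin X W \<and> openin X W \<and> Q W"
proof -
  have "\<exists>U. compactin X U \<and> openin X U \<and> Q U \<and> x \<in> U" if "x \<in> C" for x
    using nbhd[OF that] compact_open_neighbourhood[OF lc H td] hereditary by metis
  then have "C \<subseteq> \<Union>{U. compactin X U \<and> openin X U \<and> Q U}"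
    by blast
  then obtain \<F> where \<F>: "finite \<F>" "\<F> \<subseteq> {U. compactin X U \<and> openin X U \<and> Q U}" "C \<subseteq> \<Union>\<F>"
    using C unfolding compactin_def by (metis (no_types, lifting) mem_Collect_eq)
  have "\<exists>\<W>. finite \<W> \<and> pairwise disjnt \<W> \<and> \<Union>\<W> = \<Union>\<F> \<and>
      (\<forall>W\<in>\<W>. compactin X W \<and> openin X W \<and> Q W)"
    using \<F>(1,2)
  proof (induction \<F> rule: finite_induct)
    case empty
    then show ?case
      by (intro exI[of _ "{}"]) auto
  next
    case (insert U \<F>)
    then obtain \<W> where \<W>: "finite \<W>" "pairwise disjnt \<W>" "\<Union>\<W> = \<Union>\<F>"
        "\<And>W. W \<in> \<W> \<Longrightarrow> compactin X W \<and> openin X W \<and> Q W"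
      by auto
    let ?V = "U - \<Union>\<W>"
    have "compactin X (\<Union>\<W>)" "openin X (\<Union>\<W>)"
      using \<W>(1,4) by (auto intro!: compactin_Union)
    then have "compactin X ?V" "openin X ?V"
      using insert.prems compact_open_Diff[OF H] by auto
    moreover have "Q ?V"
      using insert.prems hereditary[of U ?V] by auto
    moreover have "pairwise disjnt (insert ?V \<W>)"
      using \<W>(2) by (auto simp: pairwise_def disjnt_iff)
    ultimately show ?case
      using \<W> by (intro exI[of _ "insert ?V \<W>"]) auto
  qed
  with \<F>(3) that show thesis
    by metis
qed

lemma left_span_zero: "(\<lambda>_. 0) \<in> left_span B"
  unfolding left_span_def by (intro CollectI exI[of _ "{}"]) auto

lemma left_span_scale:
  assumes "f \<in> B"
  shows "(\<lambda>\<gamma>. k * f \<gamma>) \<in> left_span B"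
  unfolding left_span_def by (intro CollectI exI[of _ "{f}"] exI[of _ "\<lambda>_. k"]) (use assms in auto)

lemma left_span_add:
  fixes f h :: "'a \<Rightarrow> 'r::{ring, monoid_mult}"
  assumes "f \<in> left_span B" "h \<in> left_span B"
  shows "(\<lambda>\<gamma>. f \<gamma> + h \<gamma>) \<in> left_span B"
proof -
  obtain S c where S: "f = (\<lambda>\<gamma>. \<Sum>b\<in>S. c b * b \<gamma>)" "finite S" "S \<subseteq> B"
    using assms(1) unfolding left_span_def by blast
  obtain T d where T: "h = (\<lambda>\<gamma>. \<Sum>b\<in>T. d b * b \<gamma>)" "finite T" "T \<subseteq> B"
    using assms(2) unfolding left_span_def by blast
  let ?c = "\<lambda>b. if b \<in> S then c b else 0" and ?d = "\<lambda>b. if b \<in> T then d b else 0"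
  have "f \<gamma> = (\<Sum>b\<in>S \<union> T. ?c b * b \<gamma>)" for \<gamma>
    unfolding S(1) using S(2) T(2) by (intro sum.mono_neutral_cong_left) auto
  moreover have "h \<gamma> = (\<Sum>b\<in>S \<union> T. ?d b * b \<gamma>)" for \<gamma>
    unfolding T(1) using S(2) T(2) by (intro sum.mono_neutral_cong_left) auto
  ultimately have "(\<lambda>\<gamma>. f \<gamma> + h \<gamma>) = (\<lambda>\<gamma>. \<Sum>b\<in>S \<union> T. (?c b + ?d b) * b \<gamma>)"
    by (simp add: distrib_right sum.distrib)
  then show ?thesis
    unfolding left_span_def using S T
    by (intro CollectI exI[of _ "S \<union> T"] exI[of _ "\<lambda>b. ?c b + ?d b"]) auto
qed

lemma left_span_sum:
  assumes "finite I" "\<And>i. i \<in> I \<Longrightarrow> f i \<in> left_span B"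
  shows "(\<lambda>\<gamma>. \<Sum>i\<in>I. f i \<gamma>) \<in> left_span B"
  using assms by (induction I rule: finite_induct) (auto simp: left_span_zero left_span_add)

lemma compact_open_preimage_of_span:
  fixes f :: "'a \<Rightarrow> 'r::{ring, monoid_mult}"
  assumes H: "Hausdorff_space T"
    and f: "f \<in> left_span {char_fun U | U. U \<in> \<U>}"
    and \<U>: "\<forall>U\<in>\<U>. compactin T U \<and> openin T U"
  shows "finite (range f)" 
    and "\<exists>K. compactin T K \<and> K \<subseteq> \<Union>\<U> \<and> {\<gamma>. f \<gamma> \<noteq> 0} \<subseteq> K"
    and "openin T {\<gamma> \<in> topspace T. f \<gamma> \<in> R}"
proof -
  obtain S c where S: "f = (\<lambda>\<gamma>. \<Sum>b\<in>S. c b * b \<gamma>)" "finite S" "S \<subseteq> {char_fun U | U. U \<in> \<U>}"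
    using f unfolding left_span_def by blast
  have "finite (range f) \<and> (\<exists>K. compactin T K \<and> K \<subseteq> \<Union>\<U> \<and> {\<gamma>. f \<gamma> \<noteq> 0} \<subseteq> K) \<and>
      (\<forall>R. openin T {\<gamma> \<in> topspace T. f \<gamma> \<in> R})"
    using S(2,3) unfolding S(1)
  proof (induction S rule: finite_induct)
    case empty
    have "openin T {\<gamma> \<in> topspace T. (0::'r) \<in> R}" for R
      by (cases "0 \<in> R") auto
    then show ?case
      by (auto intro!: exI[of _ "{}"])
  next
    case (insert b S)
    let ?h = "\<lambda>\<gamma>. \<Sum>b\<in>S. c b * b \<gamma>"
    obtain U where U: "b = char_fun U" "compactin T U" "openin T U" "U \<in> \<U>"
      using insert.prems \<U> by blast
    have IH: "finite (range ?h)" "\<And>R. openin T {\<gamma> \<in> topspace T. ?h \<gamma> \<in> R}"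
      using insert by auto
    obtain K where K: "compactin T K" "K \<subseteq> \<Union>\<U>" "{\<gamma>. ?h \<gamma> \<noteq> 0} \<subseteq> K"
      using insert by auto
    have eq: "(\<Sum>b\<in>insert b S. c b * b \<gamma>) = (if \<gamma> \<in> U then c b + ?h \<gamma> else ?h \<gamma>)" for \<gamma>
      using insert.hyps by (simp add: U(1) char_fun_def)
    have "openin T {\<gamma> \<in> topspace T. (if \<gamma> \<in> U then c b + ?h \<gamma> else ?h \<gamma>) \<in> R}" for R
    proof -
      have "openin T ((U \<inter> {\<gamma> \<in> topspace T. ?h \<gamma> \<in> {r. c b + r \<in> R}}) \<union>
          ({\<gamma> \<in> topspace T. ?h \<gamma> \<in> R} - U))"
        by (intro openin_Un openin_Int openin_diff U IH(2) compactin_imp_closedin[OF H])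
      also have "(U \<inter> {\<gamma> \<in> topspace T. ?h \<gamma> \<in> {r. c b + r \<in> R}}) \<union>
          ({\<gamma> \<in> topspace T. ?h \<gamma> \<in> R} - U) =
          {\<gamma> \<in> topspace T. (if \<gamma> \<in> U then c b + ?h \<gamma> else ?h \<gamma>) \<in> R}"
        using openin_subset[OF U(3)] by auto
      finally show ?thesis .
    qed
    moreover have "finite (range (\<lambda>\<gamma>. if \<gamma> \<in> U then c b + ?h \<gamma> else ?h \<gamma>))"
    proof (rule finite_subset)
      show "range (\<lambda>\<gamma>. if \<gamma> \<in> U then c b + ?h \<gamma> else ?h \<gamma>) \<subseteq>
          (\<lambda>r. c b + r) ` range ?h \<union> range ?h"
        by auto
    qed (use IH in auto)
    moreover have "compactin T (U \<union> K)" "U \<union> K \<subseteq> \<Union>\<U>"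
      using U K compactin_Un by auto
    moreover have "{\<gamma>. (if \<gamma> \<in> U then c b + ?h \<gamma> else ?h \<gamma>) \<noteq> 0} \<subseteq> U \<union> K"
      using K(3) by auto
    ultimately show ?case
      unfolding eq by blast
  qed
  then show "finite (range f)" "\<exists>K. compactin T K \<and> K \<subseteq> \<Union>\<U> \<and> {\<gamma>. f \<gamma> \<noteq> 0} \<subseteq> K"
    "openin T {\<gamma> \<in> topspace T. f \<gamma> \<in> R}"
    by auto
qed

subsection \<open>The topology of Deaconu--Renault groupoids\<close>

locale dr_action = partial_local_homeo_action X P act + G: group G
  for X :: "'x topology" and P :: "('p, 'm) monoid_scheme" (structure)
    and act :: "'x \<Rightarrow> 'p \<Rightarrow> 'x option" and G :: "('g, 'n) monoid_scheme" +
  fixes \<iota> :: "'p \<Rightarrow> 'g"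
  assumes \<iota>_hom: "\<iota> \<in> hom P G" and \<iota>_inj: "inj_on \<iota> (carrier P)"
    and Hausdorff: "Hausdorff_space X"
    and directed: "directed_action X P act"
begin

abbreviation dom :: "'p \<Rightarrow> 'x set" where
  "dom p \<equiv> act_dom X act p"

abbreviation \<alpha> :: "'p \<Rightarrow> 'x \<Rightarrow> 'x" where
  "\<alpha> p x \<equiv> the (act x p)"

abbreviation T :: "('x \<times> 'g \<times> 'x) topology" where
  "T \<equiv> dr_topology X P act G \<iota>"

abbreviation \<G> :: "('x \<times> 'g \<times> 'x) groupoid" where
  "\<G> \<equiv> dr_groupoid X P act G \<iota>"

abbreviation D :: "'x set \<Rightarrow> 'p \<Rightarrow> 'p \<Rightarrow> 'x set \<Rightarrow> ('x \<times> 'g \<times> 'x) set" where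
  "D U p q V \<equiv> dr_arrows X P act G \<iota> U p q V"

abbreviation quot :: "'p \<Rightarrow> 'p \<Rightarrow> 'g" where
  "quot p q \<equiv> \<iota> p \<otimes>\<^bsub>G\<^esub> inv\<^bsub>G\<^esub> \<iota> q"

lemma \<iota>_closed [simp]: "p \<in> carrier P \<Longrightarrow> \<iota> p \<in> carrier G"
  using \<iota>_hom by (auto simp: hom_def)

lemma \<iota>_mult: "p \<in> carrier P \<Longrightarrow> q \<in> carrier P \<Longrightarrow> \<iota> (p \<otimes> q) = \<iota> p \<otimes>\<^bsub>G\<^esub> \<iota> q"
  using \<iota>_hom by (auto simp: hom_def)

lemma inv_quot: "p \<in> carrier P \<Longrightarrow> q \<in> carrier P \<Longrightarrow> inv\<^bsub>G\<^esub> quot p q = quot q p"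
  by (simp add: G.inv_mult_group)

lemma quot_mult_right:
  assumes "p \<in> carrier P" "q \<in> carrier P" "s \<in> carrier P"
  shows "quot (p \<otimes> s) (q \<otimes> s) = quot p q"
proof -
  have "\<iota> s \<otimes>\<^bsub>G\<^esub> (inv\<^bsub>G\<^esub> \<iota> s \<otimes>\<^bsub>G\<^esub> inv\<^bsub>G\<^esub> \<iota> q) = inv\<^bsub>G\<^esub> \<iota> q"
    using assms by (simp add: G.m_assoc[symmetric])
  then show ?thesis
    using assms by (simp add: \<iota>_mult G.inv_mult_group G.m_assoc)
qed

lemma quot_left_determines_right:
  assumes P: "p \<in> carrier P" "q \<in> carrier P" "q' \<in> carrier P" and eq: "quot p q = quot p q'"
  shows "q = q'"
proof -
  have "inv\<^bsub>G\<^esub> \<iota> q = inv\<^bsub>G\<^esub> \<iota> q'"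
    using eq by (rule G.l_cancel) (use P in simp_all)
  then have "inv\<^bsub>G\<^esub> (inv\<^bsub>G\<^esub> \<iota> q) = inv\<^bsub>G\<^esub> (inv\<^bsub>G\<^esub> \<iota> q')"
    by (rule arg_cong)
  then have "\<iota> q = \<iota> q'"
    using P by simp
  then show ?thesis
    using P \<iota>_inj by (auto dest: inj_onD)
qed

lemma quot_eq_one_imp_eq:
  assumes "p \<in> carrier P" "q \<in> carrier P" "quot p q = \<one>\<^bsub>G\<^esub>"
  shows "p = q"
  using quot_left_determines_right[of p p q] assms by simp

lemma dom_subset: "dom p \<subseteq> topspace X"
  by (auto simp: act_dom_def)

lemma \<alpha>_mult:
  "\<lbrakk>p \<in> carrier P; q \<in> carrier P; x \<in> dom (p \<otimes> q)\<rbrakk> \<Longrightarrow> \<alpha> (p \<otimes> q) x = \<alpha> q (\<alpha> p x)"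
  using act_mult by simp

lemma \<alpha>_in_topspace: "p \<in> carrier P \<Longrightarrow> x \<in> dom p \<Longrightarrow> \<alpha> p x \<in> topspace X"
  using ran_open[of p] openin_subset unfolding act_ran_def by blast

lemma dom_one: "dom \<one> = topspace X"
  using act_one by (auto simp: act_dom_def)

lemma mem_D:
  "(x, h, y) \<in> D U p q V \<longleftrightarrow>
    h = quot p q \<and> x \<in> U \<and> y \<in> V \<and> x \<in> dom p \<and> y \<in> dom q \<and> \<alpha> p x = \<alpha> q y"
  by (auto simp: dr_arrows_def act_dom_def)

lemma local_homeomorphism:
  assumes "p \<in> carrier P" "x \<in> dom p"
  obtains W where "openin X W" "x \<in> W" "W \<subseteq> dom p" "openin X (\<alpha> p ` W)"
    "homeomorphic_map (subtopology X W) (subtopology X (\<alpha> p ` W)) (\<alpha> p)"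
proof -
  let ?X = "subtopology X (dom p)" and ?Y = "subtopology X (act_ran X act p)"
  have "x \<in> topspace ?X"
    using assms dom_subset by auto
  then obtain W where W: "openin ?X W" "x \<in> W" "restricts_to_homeo ?X ?Y (\<alpha> p) W"
    using act_local_homeo[OF assms(1)] unfolding local_homeo_def by blast
  have "openin X W" "W \<subseteq> dom p"
    using W(1) openin_open_subtopology[OF dom_open[OF assms(1)]] by simp_all
  moreover have "openin X (\<alpha> p ` W)" "\<alpha> p ` W \<subseteq> act_ran X act p"
    using W(3) openin_open_subtopology[OF ran_open[OF assms(1)]]
    unfolding restricts_to_homeo_def by simp_all
  moreover have "homeomorphic_map (subtopology X W) (subtopology X (\<alpha> p ` W)) (\<alpha> p)"
    using W(3) \<open>W \<subseteq> dom p\<close> \<open>\<alpha> p ` W \<subseteq> act_ran X act p\<close>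
    unfolding restricts_to_homeo_def subtopology_subtopology by (simp add: inf.absorb2)
  ultimately show thesis
    using that W(2) by blast
qed

lemma openin_preimage:
  assumes p: "p \<in> carrier P" and O: "openin X V"
  shows "openin X {x \<in> dom p. \<alpha> p x \<in> V}"
proof (subst openin_subopen, intro ballI)
  fix x assume x: "x \<in> {x \<in> dom p. \<alpha> p x \<in> V}"
  then obtain W where W: "openin X W" "x \<in> W" "W \<subseteq> dom p"
    "homeomorphic_map (subtopology X W) (subtopology X (\<alpha> p ` W)) (\<alpha> p)"
    using local_homeomorphism[OF p] by blast
  then have "continuous_map (subtopology X W) X (\<alpha> p)"
    using homeomorphic_imp_continuous_map[OF W(4)] by (simp add: continuous_map_in_subtopology)
  then have "openin (subtopology X W) {y \<in> topspace (subtopology X W). \<alpha> p y \<in> V}"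
    by (rule openin_continuous_map_preimage[OF _ O])
  then have "openin X {y \<in> topspace (subtopology X W). \<alpha> p y \<in> V}"
    by (simp add: openin_open_subtopology[OF W(1)])
  then show "\<exists>S. openin X S \<and> x \<in> S \<and> S \<subseteq> {x \<in> dom p. \<alpha> p x \<in> V}"
    using x W openin_subset[OF W(1)]
    by (intro exI[of _ "{y \<in> topspace (subtopology X W). \<alpha> p y \<in> V}"] conjI) auto
qed

lemma openin_image:
  assumes p: "p \<in> carrier P" and V: "openin X V" "V \<subseteq> dom p"
  shows "openin X (\<alpha> p ` V)"
proof (subst openin_subopen, intro ballI)
  fix z assume "z \<in> \<alpha> p ` V"
  then obtain x where x: "x \<in> V" "z = \<alpha> p x"
    by blast
  then obtain W where W: "openin X W" "x \<in> W" "W \<subseteq> dom p" "openin X (\<alpha> p ` W)"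
    "homeomorphic_map (subtopology X W) (subtopology X (\<alpha> p ` W)) (\<alpha> p)"
    using local_homeomorphism[OF p] V by blast
  have "openin (subtopology X W) (V \<inter> W)"
    using V W by (simp add: openin_subtopology_Int)
  then have "openin (subtopology X (\<alpha> p ` W)) (\<alpha> p ` (V \<inter> W))"
    using homeomorphic_imp_open_map[OF W(5)] unfolding open_map_def by blast
  then have "openin X (\<alpha> p ` (V \<inter> W))"
    by (simp add: openin_open_subtopology[OF W(4)])
  then show "\<exists>S. openin X S \<and> z \<in> S \<and> S \<subseteq> \<alpha> p ` V"
    using x W(2) by (intro exI conjI) auto
qed

lemma locally_injective:
  assumes "p \<in> carrier P" "x \<in> dom p"
  obtains W where "openin X W" "x \<in> W" "W \<subseteq> dom p" "inj_on (\<alpha> p) W"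
proof -
  obtain W where W: "openin X W" "x \<in> W" "W \<subseteq> dom p"
    "homeomorphic_map (subtopology X W) (subtopology X (\<alpha> p ` W)) (\<alpha> p)"
    using local_homeomorphism[OF assms] by blast
  then have "inj_on (\<alpha> p) W"
    using homeomorphic_imp_injective_map[OF W(4)] openin_subset[OF W(1)]
    by (simp add: inf.absorb2)
  with that W show thesis
    by blast
qed

lemma compactin_image:
  assumes p: "p \<in> carrier P" and V: "compactin X V" "V \<subseteq> dom p"
  shows "compactin X (\<alpha> p ` V)"
proof -
  have "continuous_map (subtopology X (dom p)) X (\<alpha> p)"
    unfolding continuous_map_def
  proof (intro conjI allI impI)
    show "\<alpha> p \<in> topspace (subtopology X (dom p)) \<rightarrow> topspace X"
      using \<alpha>_in_topspace[OF p] by auto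
    fix U assume "openin X U"
    then have "openin X {x \<in> dom p. \<alpha> p x \<in> U}"
      by (rule openin_preimage[OF p])
    moreover have "{x \<in> topspace (subtopology X (dom p)). \<alpha> p x \<in> U} = {x \<in> dom p. \<alpha> p x \<in> U}"
      using dom_subset by auto
    ultimately show "openin (subtopology X (dom p)) {x \<in> topspace (subtopology X (dom p)). \<alpha> p x \<in> U}"
      using openin_open_subtopology[OF dom_open[OF p]] by auto
  qed
  moreover have "compactin (subtopology X (dom p)) V"
    using V by (simp add: compactin_subtopology)
  ultimately show ?thesis
    using image_compactin by blast
qed

lemma common_refinement_dom:
  assumes P: "p \<in> carrier P" "q \<in> carrier P" "p' \<in> carrier P" "q' \<in> carrier P"
    and eq: "quot p q = quot p' q'" and x: "x \<in> dom p" "x \<in> dom p'"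
  obtains s s' where "s \<in> carrier P" "s' \<in> carrier P" "p \<otimes> s = p' \<otimes> s'" "q \<otimes> s = q' \<otimes> s'"
    "dom (p \<otimes> s) = dom p \<inter> dom p'"
proof -
  have "dom p \<inter> dom p' \<noteq> {}"
    using x by blast
  then obtain r where r: "r \<in> (p <# carrier P) \<inter> (p' <# carrier P)" "dom r = dom p \<inter> dom p'"
    using directed P(1,3) unfolding directed_action_def by meson
  then obtain s s' where s: "s \<in> carrier P" "s' \<in> carrier P" "r = p \<otimes> s" "r = p' \<otimes> s'"
    unfolding l_coset_def by blast
  have "quot r (q \<otimes> s) = quot p q"
    unfolding s(3) using s(1) P by (simp only: quot_mult_right)
  moreover have "quot r (q' \<otimes> s') = quot p' q'"
    unfolding s(4) using s(2) P by (simp only: quot_mult_right)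
  ultimately have "q \<otimes> s = q' \<otimes> s'"
    using eq s P quot_left_determines_right[of r "q \<otimes> s" "q' \<otimes> s'"] by auto
  then show thesis
    using that s r(2) by auto
qed

lemma common_refinement:
  assumes P: "p \<in> carrier P" "q \<in> carrier P" "p' \<in> carrier P" "q' \<in> carrier P"
    and eq: "quot p q = quot p' q'"
    and xy: "x \<in> dom p" "y \<in> dom q" "\<alpha> p x = \<alpha> q y" and x': "x \<in> dom p'"
  obtains s s' where "s \<in> carrier P" "s' \<in> carrier P" "p \<otimes> s = p' \<otimes> s'" "q \<otimes> s = q' \<otimes> s'"
    "x \<in> dom (p \<otimes> s)" "y \<in> dom (q \<otimes> s)"
proof -
  from common_refinement_dom[OF P eq xy(1) x']
  obtain s s' where s: "s \<in> carrier P" "s' \<in> carrier P" "p \<otimes> s = p' \<otimes> s'" "q \<otimes> s = q' \<otimes> s'"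
    "dom (p \<otimes> s) = dom p \<inter> dom p'" .
  have "x \<in> dom (p \<otimes> s)"
    using s(5) xy(1) x' by auto
  moreover have "y \<in> dom (q \<otimes> s)"
    using \<open>x \<in> dom (p \<otimes> s)\<close> dom_mult P s(1) xy by auto
  ultimately show thesis
    using that s(1-4) by blast
qed

lemma dom_transfer:
  assumes P: "p \<in> carrier P" "q \<in> carrier P" "p' \<in> carrier P" "q' \<in> carrier P"
    and eq: "quot p q = quot p' q'"
    and xy: "x \<in> dom p" "y \<in> dom q" "\<alpha> p x = \<alpha> q y"
  shows "x \<in> dom p' \<longleftrightarrow> y \<in> dom q'"
proof
  assume "x \<in> dom p'"
  from common_refinement[OF P eq xy this]
  obtain s s' where "s' \<in> carrier P" "q \<otimes> s = q' \<otimes> s'" "y \<in> dom (q \<otimes> s)" .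
  then show "y \<in> dom q'"
    using dom_mult P by simp
next
  assume y: "y \<in> dom q'"
  have "quot q p = quot q' p'"
    using arg_cong[OF eq, of "\<lambda>g. inv\<^bsub>G\<^esub> g"] P by (simp only: inv_quot)
  from common_refinement[OF P(2,1,4,3) this xy(2,1) xy(3)[symmetric] y]
  obtain s s' where "s' \<in> carrier P" "p \<otimes> s = p' \<otimes> s'" "x \<in> dom (p \<otimes> s)" .
  then show "x \<in> dom p'"
    using dom_mult P by simp
qed

lemma topspace_T:
  "(x, g, y) \<in> topspace T \<longleftrightarrow>
    (\<exists>p\<in>carrier P. \<exists>q\<in>carrier P. (x, g, y) \<in> D (topspace X) p q (topspace X))"
  (is "?L \<longleftrightarrow> ?R")
proof
  assume ?L
  then obtain U V p q where "openin X U" "openin X V" "p \<in> carrier P" "q \<in> carrier P"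
    "(x, g, y) \<in> D U p q V"
    unfolding dr_topology_def topology_generated_by_topspace by blast
  then show ?R
    using openin_subset[of X U] openin_subset[of X V] unfolding mem_D by blast
next
  assume ?R
  then show ?L
    unfolding dr_topology_def topology_generated_by_topspace by blast
qed

lemma D_subset_topspace: "p \<in> carrier P \<Longrightarrow> q \<in> carrier P \<Longrightarrow> D U p q V \<subseteq> topspace T"
proof
  fix \<gamma> assume P: "p \<in> carrier P" "q \<in> carrier P" and \<gamma>: "\<gamma> \<in> D U p q V"
  obtain x h y where xy: "\<gamma> = (x, h, y)"
    by (metis surj_pair)
  have "\<gamma> \<in> D (topspace X) p q (topspace X)"
    using \<gamma> dom_subset unfolding xy mem_D by blast
  then show "\<gamma> \<in> topspace T"
    unfolding xy topspace_T using P by blast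
qed

lemma openin_D:
  "\<lbrakk>openin X U; openin X V; p \<in> carrier P; q \<in> carrier P\<rbrakk> \<Longrightarrow> openin T (D U p q V)"
  unfolding dr_topology_def by (rule topology_generated_by_Basis) blast

lemma D_Int_neighbourhood:
  assumes P: "p \<in> carrier P" "q \<in> carrier P" "p' \<in> carrier P" "q' \<in> carrier P"
    and op: "openin X U" "openin X V" "openin X U'" "openin X V'"
    and \<gamma>: "(x, g, y) \<in> D U p q V" "(x, g, y) \<in> D U' p' q' V'"
  obtains U'' V'' where "openin X U''" "openin X V''"
    "(x, g, y) \<in> D U'' p q V''" "D U'' p q V'' \<subseteq> D U p q V \<inter> D U' p' q' V'"
proof -
  have eq: "quot p q = quot p' q'" "g = quot p q"
    and xy: "x \<in> dom p" "y \<in> dom q" "\<alpha> p x = \<alpha> q y"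
    and xy': "x \<in> dom p'" "y \<in> dom q'" "\<alpha> p' x = \<alpha> q' y"
    and UV: "x \<in> U" "y \<in> V" "x \<in> U'" "y \<in> V'"
    using \<gamma> by (auto simp: mem_D)
  obtain s s' where s: "s \<in> carrier P" "s' \<in> carrier P" "p \<otimes> s = p' \<otimes> s'" "q \<otimes> s = q' \<otimes> s'"
    "x \<in> dom (p \<otimes> s)" "y \<in> dom (q \<otimes> s)"
    using common_refinement[OF P eq(1) xy xy'(1)] by metis
  have "\<alpha> p' x \<in> dom s'"
    using s P dom_mult by auto
  then obtain N where N: "openin X N" "\<alpha> p' x \<in> N" "N \<subseteq> dom s'" "inj_on (\<alpha> s') N"
    using locally_injective[OF s(2)] by metis
  let ?U = "U \<inter> U' \<inter> dom (p \<otimes> s) \<inter> {x \<in> dom p'. \<alpha> p' x \<in> N}"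
  let ?V = "V \<inter> V' \<inter> dom (q \<otimes> s) \<inter> {y \<in> dom q'. \<alpha> q' y \<in> N}"
  show thesis
  proof
    show "openin X ?U" "openin X ?V"
      using op P s N by (auto intro!: openin_Int openin_preimage dom_open)
    show "(x, g, y) \<in> D ?U p q ?V"
      using eq UV s xy xy' N by (simp add: mem_D)
    show "D ?U p q ?V \<subseteq> D U p q V \<inter> D U' p' q' V'"
    proof (rule subsetI)
      fix \<gamma> assume "\<gamma> \<in> D ?U p q ?V"
      then obtain a h b where \<gamma>: "\<gamma> = (a, h, b)" "(a, h, b) \<in> D ?U p q ?V"
        by (metis surj_pair)
      then have h: "h = quot p q" and a: "a \<in> ?U" and b: "b \<in> ?V"
        and ab: "a \<in> dom p" "b \<in> dom q" "\<alpha> p a = \<alpha> q b"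
        by (simp_all only: mem_D)
      have "\<alpha> s' (\<alpha> p' a) = \<alpha> s (\<alpha> p a)"
        using a s P \<alpha>_mult by (metis IntD1 IntD2)
      also have "\<dots> = \<alpha> s (\<alpha> q b)"
        using ab by simp
      also have "\<dots> = \<alpha> s' (\<alpha> q' b)"
        using b s P \<alpha>_mult by (metis IntD1 IntD2)
      finally have "\<alpha> p' a = \<alpha> q' b"
        using a b N(4) by (auto dest: inj_onD)
      then show "\<gamma> \<in> D U p q V \<inter> D U' p' q' V'"
        using h eq a b ab by (auto simp: \<gamma>(1) mem_D)
    qed
  qed
qed

lemma openin_T_basis:
  assumes "openin T S" "(x, g, y) \<in> S"
  obtains U V p q where "openin X U" "openin X V" "p \<in> carrier P" "q \<in> carrier P"
    "(x, g, y) \<in> D U p q V" "D U p q V \<subseteq> S"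
proof -
  let ?\<B> = "{D U p q V | U p q V. openin X U \<and> openin X V \<and> p \<in> carrier P \<and> q \<in> carrier P}"
  have "generate_topology_on ?\<B> S"
    using assms(1) unfolding dr_topology_def by (rule openin_topology_generated_by)
  then have "\<forall>x g y. (x, g, y) \<in> S \<longrightarrow> (\<exists>U V p q. openin X U \<and> openin X V \<and>
      p \<in> carrier P \<and> q \<in> carrier P \<and> (x, g, y) \<in> D U p q V \<and> D U p q V \<subseteq> S)"
  proof (induction rule: generate_topology_on.induct)
    case (Int S S')
    show ?case
    proof (intro allI impI)
      fix x g y assume "(x, g, y) \<in> S \<inter> S'"
      then have \<gamma>S: "(x, g, y) \<in> S" "(x, g, y) \<in> S'"
        by auto
      from Int.IH(1)[rule_format, OF \<gamma>S(1)]
      obtain U V p q where 1: "openin X U" "openin X V" "p \<in> carrier P" "q \<in> carrier P"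
        "(x, g, y) \<in> D U p q V" "D U p q V \<subseteq> S"
        by metis
      from Int.IH(2)[rule_format, OF \<gamma>S(2)]
      obtain U' V' p' q' where 2: "openin X U'" "openin X V'" "p' \<in> carrier P" "q' \<in> carrier P"
        "(x, g, y) \<in> D U' p' q' V'" "D U' p' q' V' \<subseteq> S'"
        by metis
      from D_Int_neighbourhood[OF 1(3,4) 2(3,4) 1(1,2) 2(1,2) 1(5) 2(5)]
      obtain U'' V'' where "openin X U''" "openin X V''" "(x, g, y) \<in> D U'' p q V''"
        "D U'' p q V'' \<subseteq> D U p q V \<inter> D U' p' q' V'" .
      moreover from this(4) have "D U'' p q V'' \<subseteq> S \<inter> S'"
        using 1(6) 2(6) by blast
      ultimately show "\<exists>U V p q. openin X U \<and> openin X V \<and> p \<in> carrier P \<and> q \<in> carrier P \<and>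
          (x, g, y) \<in> D U p q V \<and> D U p q V \<subseteq> S \<inter> S'"
        using 1(3,4) by meson
    qed
  next
    case (UN K)
    show ?case
    proof (intro allI impI)
      fix x g y assume "(x, g, y) \<in> \<Union>K"
      then obtain S where S: "S \<in> K" "(x, g, y) \<in> S"
        by blast
      from UN.IH[OF S(1)] S(2)
      obtain U V p q where "openin X U" "openin X V" "p \<in> carrier P" "q \<in> carrier P"
        "(x, g, y) \<in> D U p q V" "D U p q V \<subseteq> S"
        by metis
      moreover have "S \<subseteq> \<Union>K"
        using S(1) by blast
      ultimately show "\<exists>U V p q. openin X U \<and> openin X V \<and> p \<in> carrier P \<and> q \<in> carrier P \<and>
          (x, g, y) \<in> D U p q V \<and> D U p q V \<subseteq> \<Union>K"
        by (meson order_trans)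
    qed
  next
    case (Basis S)
    then show ?case
      by blast
  qed auto
  with assms(2) that show thesis
    by metis
qed

lemma openin_fst_image:
  assumes "openin T S"
  shows "openin X (fst ` S)"
proof (subst openin_subopen, intro ballI)
  fix x assume "x \<in> fst ` S"
  then obtain g y where "(x, g, y) \<in> S"
    by auto
  then obtain U V p q where B: "openin X U" "openin X V" "p \<in> carrier P" "q \<in> carrier P"
    "(x, g, y) \<in> D U p q V" "D U p q V \<subseteq> S"
    using openin_T_basis[OF assms] by metis
  let ?W = "U \<inter> {x \<in> dom p. \<alpha> p x \<in> \<alpha> q ` (V \<inter> dom q)}"
  have "openin X ?W"
    using B by (intro openin_Int openin_preimage openin_image dom_open) auto
  moreover have "x \<in> ?W"
    using B(5) by (auto simp: mem_D)
  moreover have "?W \<subseteq> fst ` S"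
  proof
    fix a assume "a \<in> ?W"
    then obtain b where "(a, quot p q, b) \<in> D U p q V"
      by (auto simp: mem_D)
    with B(6) show "a \<in> fst ` S"
      by force
  qed
  ultimately show "\<exists>W. openin X W \<and> x \<in> W \<and> W \<subseteq> fst ` S"
    by blast
qed

lemma openin_snd_image:
  assumes "openin T S"
  shows "openin X ((\<lambda>\<gamma>. snd (snd \<gamma>)) ` S)"
proof (subst openin_subopen, intro ballI)
  fix y assume "y \<in> (\<lambda>\<gamma>. snd (snd \<gamma>)) ` S"
  then obtain x g where "(x, g, y) \<in> S"
    by auto
  then obtain U V p q where B: "openin X U" "openin X V" "p \<in> carrier P" "q \<in> carrier P"
    "(x, g, y) \<in> D U p q V" "D U p q V \<subseteq> S"
    using openin_T_basis[OF assms] by metis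
  let ?W = "V \<inter> {y \<in> dom q. \<alpha> q y \<in> \<alpha> p ` (U \<inter> dom p)}"
  have "openin X ?W"
    using B by (intro openin_Int openin_preimage openin_image dom_open) auto
  moreover have "y \<in> ?W"
    using B(5) by (auto simp: mem_D intro!: image_eqI[of _ _ x])
  moreover have "?W \<subseteq> (\<lambda>\<gamma>. snd (snd \<gamma>)) ` S"
  proof
    fix b assume "b \<in> ?W"
    then obtain a where "(a, quot p q, b) \<in> D U p q V"
      by (fastforce simp: mem_D)
    with B(6) show "b \<in> (\<lambda>\<gamma>. snd (snd \<gamma>)) ` S"
      by force
  qed
  ultimately show "\<exists>W. openin X W \<and> y \<in> W \<and> W \<subseteq> (\<lambda>\<gamma>. snd (snd \<gamma>)) ` S"
    by blast
qed

lemma continuous_map_fst: "continuous_map T X fst"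
  unfolding continuous_map_def
proof (intro conjI allI impI)
  show "fst \<in> topspace T \<rightarrow> topspace X"
    by (auto simp: topspace_T mem_D)
  fix U assume U: "openin X U"
  show "openin T {\<gamma> \<in> topspace T. fst \<gamma> \<in> U}"
  proof (subst openin_subopen, intro ballI)
    fix \<gamma> assume \<gamma>: "\<gamma> \<in> {\<gamma> \<in> topspace T. fst \<gamma> \<in> U}"
    obtain x g y where xy: "\<gamma> = (x, g, y)"
      by (metis surj_pair)
    then obtain p q where P: "p \<in> carrier P" "q \<in> carrier P" "\<gamma> \<in> D (topspace X) p q (topspace X)"
      using \<gamma> topspace_T by auto
    have "openin T (D U p q (topspace X))"
      using openin_D U P by blast
    moreover have "\<gamma> \<in> D U p q (topspace X)"
      using P(3) \<gamma> unfolding xy mem_D by simp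
    moreover have "D U p q (topspace X) \<subseteq> {\<gamma> \<in> topspace T. fst \<gamma> \<in> U}"
      using openin_subset[OF \<open>openin T (D U p q (topspace X))\<close>] by (auto simp: mem_D)
    ultimately show "\<exists>S. openin T S \<and> \<gamma> \<in> S \<and> S \<subseteq> {\<gamma> \<in> topspace T. fst \<gamma> \<in> U}"
      by blast
  qed
qed

lemma continuous_map_snd: "continuous_map T X (\<lambda>\<gamma>. snd (snd \<gamma>))"
  unfolding continuous_map_def
proof (intro conjI allI impI)
  show "(\<lambda>\<gamma>. snd (snd \<gamma>)) \<in> topspace T \<rightarrow> topspace X"
    by (auto simp: topspace_T mem_D)
  fix U assume U: "openin X U"
  show "openin T {\<gamma> \<in> topspace T. snd (snd \<gamma>) \<in> U}"
  proof (subst openin_subopen, intro ballI)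
    fix \<gamma> assume \<gamma>: "\<gamma> \<in> {\<gamma> \<in> topspace T. snd (snd \<gamma>) \<in> U}"
    obtain x g y where xy: "\<gamma> = (x, g, y)"
      by (metis surj_pair)
    then obtain p q where P: "p \<in> carrier P" "q \<in> carrier P" "\<gamma> \<in> D (topspace X) p q (topspace X)"
      using \<gamma> topspace_T by auto
    have "openin T (D (topspace X) p q U)"
      using openin_D U P by blast
    moreover have "\<gamma> \<in> D (topspace X) p q U"
      using P(3) \<gamma> unfolding xy mem_D by simp
    moreover have "D (topspace X) p q U \<subseteq> {\<gamma> \<in> topspace T. snd (snd \<gamma>) \<in> U}"
      using openin_subset[OF \<open>openin T (D (topspace X) p q U)\<close>] by (auto simp: mem_D)
    ultimately show "\<exists>S. openin T S \<and> \<gamma> \<in> S \<and> S \<subseteq> {\<gamma> \<in> topspace T. snd (snd \<gamma>) \<in> U}"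
      by blast
  qed
qed

lemma openin_degree: "openin T {\<gamma> \<in> topspace T. fst (snd \<gamma>) = g}"
proof -
  have "{\<gamma> \<in> topspace T. fst (snd \<gamma>) = g} =
      \<Union>{D (topspace X) p q (topspace X) | p q. p \<in> carrier P \<and> q \<in> carrier P \<and> quot p q = g}"
    (is "?L = ?R")
  proof (intro equalityI subsetI)
    fix \<gamma> assume \<gamma>: "\<gamma> \<in> ?L"
    obtain x h y where xy: "\<gamma> = (x, h, y)"
      by (metis surj_pair)
    then obtain p q where P: "p \<in> carrier P" "q \<in> carrier P" "\<gamma> \<in> D (topspace X) p q (topspace X)"
      using \<gamma> topspace_T by auto
    then have "quot p q = g"
      using \<gamma> unfolding xy mem_D by simp
    with P show "\<gamma> \<in> ?R"
      by blast
  next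
    fix \<gamma> assume "\<gamma> \<in> ?R"
    then obtain p q where P: "p \<in> carrier P" "q \<in> carrier P" "quot p q = g"
      "\<gamma> \<in> D (topspace X) p q (topspace X)"
      by blast
    obtain x h y where xy: "\<gamma> = (x, h, y)"
      by (metis surj_pair)
    have "h = g"
      using P unfolding xy mem_D by simp
    moreover have "\<gamma> \<in> topspace T"
      using P xy topspace_T by blast
    ultimately show "\<gamma> \<in> ?L"
      by (simp add: xy)
  qed
  also have "openin T \<dots>"
    using openin_D by blast
  finally show ?thesis .
qed

lemma Hausdorff_T: "Hausdorff_space T"
  unfolding Hausdorff_space_def
proof (intro allI impI, elim conjE)
  fix \<gamma> \<delta> assume \<gamma>: "\<gamma> \<in> topspace T" "\<delta> \<in> topspace T" "\<gamma> \<noteq> \<delta>"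
  have sep: "\<exists>U V. openin T U \<and> openin T V \<and> \<gamma> \<in> U \<and> \<delta> \<in> V \<and> disjnt U V"
    if f: "continuous_map T X f" and "f \<gamma> \<noteq> f \<delta>" for f
  proof -
    have "f \<gamma> \<in> topspace X" "f \<delta> \<in> topspace X"
      using f \<gamma> by (auto simp: continuous_map_def)
    then obtain U V where UV: "openin X U" "openin X V" "f \<gamma> \<in> U" "f \<delta> \<in> V" "disjnt U V"
      using Hausdorff \<open>f \<gamma> \<noteq> f \<delta>\<close> unfolding Hausdorff_space_def by metis
    then show ?thesis
      using f \<gamma> by (intro exI[of _ "{\<epsilon> \<in> topspace T. f \<epsilon> \<in> U}"] exI[of _ "{\<epsilon> \<in> topspace T. f \<epsilon> \<in> V}"])
        (auto simp: disjnt_iff openin_continuous_map_preimage)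
  qed
  show "\<exists>U V. openin T U \<and> openin T V \<and> \<gamma> \<in> U \<and> \<delta> \<in> V \<and> disjnt U V"
  proof (cases "fst (snd \<gamma>) = fst (snd \<delta>)")
    case True
    then have "fst \<gamma> \<noteq> fst \<delta> \<or> snd (snd \<gamma>) \<noteq> snd (snd \<delta>)"
      using \<gamma>(3) by (simp add: prod_eq_iff)
    then show ?thesis
      using sep[OF continuous_map_fst] sep[OF continuous_map_snd] by blast
  next
    case False
    then show ?thesis
      using \<gamma> openin_degree
      by (intro exI[of _ "{\<epsilon> \<in> topspace T. fst (snd \<epsilon>) = fst (snd \<gamma>)}"]
          exI[of _ "{\<epsilon> \<in> topspace T. fst (snd \<epsilon>) = fst (snd \<delta>)}"]) (auto simp: disjnt_iff)
  qed
qed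

lemma gsource_eq:
  assumes "(x, g, y) \<in> topspace T"
  shows "gsource \<G> (x, g, y) = (y, \<one>\<^bsub>G\<^esub>, y)"
proof -
  have "g \<in> carrier G"
    using assms by (auto simp: topspace_T mem_D)
  then show ?thesis
    by (simp add: gsource_def dr_groupoid_def)
qed

lemma grange_eq:
  assumes "(x, g, y) \<in> topspace T"
  shows "grange \<G> (x, g, y) = (x, \<one>\<^bsub>G\<^esub>, x)"
proof -
  have "g \<in> carrier G"
    using assms by (auto simp: topspace_T mem_D)
  then show ?thesis
    by (simp add: grange_def dr_groupoid_def)
qed

definition unit_arrow :: "'x \<Rightarrow> 'x \<times> 'g \<times> 'x" where
  "unit_arrow x = (x, \<one>\<^bsub>G\<^esub>, x)"

lemma unit_arrow_in_D: "x \<in> U \<Longrightarrow> x \<in> V \<Longrightarrow> x \<in> topspace X \<Longrightarrow> unit_arrow x \<in> D U \<one> \<one> V"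
  by (simp add: unit_arrow_def mem_D dom_one)

lemma unit_arrow_in_topspace: "x \<in> topspace X \<Longrightarrow> unit_arrow x \<in> topspace T"
  using unit_arrow_in_D[of x "topspace X" "topspace X"] one_closed
  unfolding unit_arrow_def topspace_T by blast

lemma gtop_dr_groupoid: "gtop \<G> = T"
  by (simp add: dr_groupoid_def)

lemma gunits_eq: "gunits \<G> = subtopology T (unit_arrow ` topspace X)"
proof -
  have "gsource \<G> ` topspace T = unit_arrow ` topspace X"
  proof (intro equalityI subsetI)
    fix u assume "u \<in> gsource \<G> ` topspace T"
    then obtain x g y where "(x, g, y) \<in> topspace T" "u = gsource \<G> (x, g, y)"
      by auto
    then show "u \<in> unit_arrow ` topspace X"
      using gsource_eq by (auto simp: unit_arrow_def topspace_T mem_D)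
  next
    fix u assume "u \<in> unit_arrow ` topspace X"
    then obtain x where x: "x \<in> topspace X" "u = unit_arrow x"
      by auto
    then have "gsource \<G> (unit_arrow x) = u"
      using gsource_eq unit_arrow_in_topspace[OF x(1)] by (simp add: unit_arrow_def)
    then show "u \<in> gsource \<G> ` topspace T"
      using unit_arrow_in_topspace[OF x(1)] by (metis imageI)
  qed
  then show ?thesis
    by (simp add: gunits_def gtop_dr_groupoid)
qed

lemma continuous_map_unit_arrow: "continuous_map X (gunits \<G>) unit_arrow"
  unfolding gunits_eq continuous_map_in_subtopology
proof (intro conjI)
  show "continuous_map X T unit_arrow"
    unfolding continuous_map_def
  proof (intro conjI allI impI)
    show "unit_arrow \<in> topspace X \<rightarrow> topspace T"
      using unit_arrow_in_topspace by auto
    fix S assume S: "openin T S"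
    show "openin X {x \<in> topspace X. unit_arrow x \<in> S}"
    proof (subst openin_subopen, intro ballI)
      fix x assume x: "x \<in> {x \<in> topspace X. unit_arrow x \<in> S}"
      then have "(x, \<one>\<^bsub>G\<^esub>, x) \<in> S"
        by (simp add: unit_arrow_def)
      from openin_T_basis[OF S this]
      obtain U V p q where B: "openin X U" "openin X V" "p \<in> carrier P" "q \<in> carrier P"
        "unit_arrow x \<in> D U p q V" "D U p q V \<subseteq> S"
        unfolding unit_arrow_def .
      have one: "quot p q = \<one>\<^bsub>G\<^esub>"
        using B(5) by (simp add: unit_arrow_def mem_D)
      then have "p = q"
        using B quot_eq_one_imp_eq by blast
      have "openin X (U \<inter> V \<inter> dom p)"
        using B by (intro openin_Int dom_open) auto
      moreover have "x \<in> U \<inter> V \<inter> dom p"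
        using B(5) by (simp add: unit_arrow_def mem_D)
      moreover have "U \<inter> V \<inter> dom p \<subseteq> {x \<in> topspace X. unit_arrow x \<in> S}"
        using B(6) one \<open>p = q\<close> dom_subset by (auto simp: unit_arrow_def mem_D)
      ultimately show "\<exists>W. openin X W \<and> x \<in> W \<and> W \<subseteq> {x \<in> topspace X. unit_arrow x \<in> S}"
        by blast
    qed
  qed
qed auto

lemma openin_gunits_image:
  assumes S: "openin X S"
  shows "openin (gunits \<G>) (unit_arrow ` S)"
proof -
  have "unit_arrow ` S = D S \<one> \<one> S \<inter> unit_arrow ` topspace X"
    using openin_subset[OF S] act_one by (auto simp: mem_D unit_arrow_def dom_one)
  then show ?thesis
    using openin_D[OF S S one_closed one_closed] unfolding gunits_eq openin_subtopology by blast
qed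

lemma compact_open_bisectionI:
  assumes B: "compactin T B" "openin T B"
    and inj: "inj_on fst B" "inj_on (\<lambda>\<gamma>. snd (snd \<gamma>)) B"
  shows "compact_open_bisection \<G> B"
proof -
  have BT: "B \<subseteq> topspace T"
    using openin_subset[OF B(2)] .
  have homeo: "restricts_to_homeo T (gunits \<G>) f B"
    if f: "\<And>\<gamma>. \<gamma> \<in> topspace T \<Longrightarrow> f \<gamma> = unit_arrow (k \<gamma>)"
      and k: "continuous_map T X k" "\<And>S. openin T S \<Longrightarrow> openin X (k ` S)" "inj_on k B" for f k
  proof -
    have img: "openin (gunits \<G>) (f ` S)" if "openin T S" for S
    proof -
      have "f ` S = unit_arrow ` k ` S"
        using f openin_subset[OF that] by force
      then show ?thesis
        using openin_gunits_image k(2)[OF that] by simp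
    qed
    have fB: "f ` B \<subseteq> topspace (gunits \<G>)"
      using openin_subset[OF img[OF B(2)]] .
    have "continuous_map T (gunits \<G>) (unit_arrow \<circ> k)"
      using k(1) continuous_map_unit_arrow by (rule continuous_map_compose)
    then have "continuous_map T (gunits \<G>) f"
      using f by (auto intro: continuous_map_eq)
    then have "continuous_map (subtopology T B) (subtopology (gunits \<G>) (f ` B)) f"
      using continuous_map_from_subtopology by (auto simp: continuous_map_in_subtopology)
    moreover have "open_map (subtopology T B) (subtopology (gunits \<G>) (f ` B)) f"
      unfolding open_map_def
    proof (intro allI impI)
      fix S assume "openin (subtopology T B) S"
      then have S: "openin T S" "S \<subseteq> B"
        using openin_open_subtopology[OF B(2)] by auto
      then show "openin (subtopology (gunits \<G>) (f ` B)) (f ` S)"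
        using img by (intro subset_openin_subtopology) auto
    qed
    moreover have "f ` topspace (subtopology T B) = topspace (subtopology (gunits \<G>) (f ` B))"
      using BT fB by (simp add: inf.absorb2)
    moreover have "inj_on f (topspace (subtopology T B))"
    proof (rule inj_onI)
      fix \<gamma> \<delta> assume "\<gamma> \<in> topspace (subtopology T B)" "\<delta> \<in> topspace (subtopology T B)" "f \<gamma> = f \<delta>"
      then show "\<gamma> = \<delta>"
        using f k(3) by (auto simp: unit_arrow_def dest: inj_onD)
    qed
    ultimately have "homeomorphic_map (subtopology T B) (subtopology (gunits \<G>) (f ` B)) f"
      by (rule bijective_open_imp_homeomorphic_map)
    then show ?thesis
      using img[OF B(2)] by (simp add: restricts_to_homeo_def)
  qed
  have "restricts_to_homeo T (gunits \<G>) (gsource \<G>) B"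
    using gsource_eq continuous_map_snd openin_snd_image inj(2)
    by (intro homeo[where k = "\<lambda>\<gamma>. snd (snd \<gamma>)"]) (auto simp: unit_arrow_def)
  moreover have "restricts_to_homeo T (gunits \<G>) (grange \<G>) B"
    using grange_eq continuous_map_fst openin_fst_image inj(1)
    by (intro homeo[where k = fst]) (auto simp: unit_arrow_def)
  ultimately show ?thesis
    using B by (simp add: compact_open_bisection_def gtop_dr_groupoid)
qed

lemma
  assumes P: "p \<in> carrier P" "q \<in> carrier P"
    and W: "compactin X W" "openin X W" "W \<subseteq> dom p" "inj_on (\<alpha> p) W"
    and Y: "compactin X Y" "openin X Y" "Y \<subseteq> dom q" "inj_on (\<alpha> q) Y"
  shows compactin_D: "compactin T (D W p q Y)"
    and compact_open_bisection_D: "compact_open_bisection \<G> (D W p q Y)"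
proof -
  let ?B = "D W p q Y"
  have B: "openin T ?B"
    using openin_D P W Y by blast
  have inj: "inj_on fst ?B" "inj_on (\<lambda>\<gamma>. snd (snd \<gamma>)) ?B"
    using W(4) Y(4) by (auto simp: inj_on_def mem_D)
  have img: "fst ` ?B = {x \<in> W. \<alpha> p x \<in> \<alpha> q ` Y}"
  proof (intro equalityI subsetI)
    fix x assume "x \<in> {x \<in> W. \<alpha> p x \<in> \<alpha> q ` Y}"
    then obtain y where "x \<in> W" "y \<in> Y" "\<alpha> p x = \<alpha> q y"
      by blast
    then have "(x, quot p q, y) \<in> ?B"
      using W(3) Y(3) by (auto simp: mem_D)
    then show "x \<in> fst ` ?B"
      by force
  qed (auto simp: mem_D)
  have "closedin X (\<alpha> q ` Y)"
    using compactin_imp_closedin[OF Hausdorff] compactin_image[OF P(2) Y(1,3)] by blast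
  then have "openin X {x \<in> dom p. \<alpha> p x \<in> topspace X - \<alpha> q ` Y}"
    using openin_preimage[OF P(1)] by blast
  then have "compactin X (W \<inter> (topspace X - {x \<in> dom p. \<alpha> p x \<in> topspace X - \<alpha> q ` Y}))"
    using W(1) by (intro compact_Int_closedin) auto
  moreover have "W \<inter> (topspace X - {x \<in> dom p. \<alpha> p x \<in> topspace X - \<alpha> q ` Y}) = fst ` ?B"
    unfolding img using W(3) \<alpha>_in_topspace[OF P(1)] openin_subset[OF W(2)] by auto
  ultimately have cpt: "compactin X (fst ` ?B)"
    by simp
  have "homeomorphic_map (subtopology T ?B) (subtopology X (fst ` ?B)) fst"
  proof (rule bijective_open_imp_homeomorphic_map)
    show "continuous_map (subtopology T ?B) (subtopology X (fst ` ?B)) fst"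
      using continuous_map_from_subtopology[OF continuous_map_fst]
      by (auto simp: continuous_map_in_subtopology)
    show "open_map (subtopology T ?B) (subtopology X (fst ` ?B)) fst"
      unfolding open_map_def
    proof (intro allI impI)
      fix S assume "openin (subtopology T ?B) S"
      then have "openin T S" "S \<subseteq> ?B"
        using openin_open_subtopology[OF B] by auto
      then show "openin (subtopology X (fst ` ?B)) (fst ` S)"
        using openin_fst_image by (intro subset_openin_subtopology) auto
    qed
    show "fst ` topspace (subtopology T ?B) = topspace (subtopology X (fst ` ?B))"
      using openin_subset[OF B] openin_subset[OF openin_fst_image[OF B]] by (simp add: inf.absorb2)
    show "inj_on fst (topspace (subtopology T ?B))"
      using inj(1) by (auto intro: inj_on_subset)
  qed
  then have "compact_space (subtopology T ?B) \<longleftrightarrow> compact_space (subtopology X (fst ` ?B))"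
    by (intro homeomorphic_compact_space homeomorphic_map_imp_homeomorphic_space)
  then show *: "compactin T ?B"
    using cpt openin_subset[OF B] by (simp add: compactin_subspace)
  show "compact_open_bisection \<G> ?B"
    using compact_open_bisectionI[OF * B inj] .
qed

lemma convolution_homogeneous:
  fixes f f' :: "'x \<times> 'g \<times> 'x \<Rightarrow> 'r::{ring, monoid_mult}"
  assumes f: "\<And>x k y. f (x, k, y) \<noteq> 0 \<Longrightarrow> (x, k, y) \<in> topspace T \<and> k = g"
    and f': "\<And>x k y. f' (x, k, y) \<noteq> 0 \<Longrightarrow> (x, k, y) \<in> topspace T \<and> k = h"
  shows "convolution \<G> f f' (x, k, y) =
    (if k = g \<otimes>\<^bsub>G\<^esub> h
     then \<Sum>z\<in>{z. f (x, g, z) \<noteq> 0 \<and> f' (z, h, y) \<noteq> 0}. f (x, g, z) * f' (z, h, y) else 0)"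
proof -
  let ?S = "{(\<beta>, \<delta>). \<beta> \<in> topspace (gtop \<G>) \<and> \<delta> \<in> topspace (gtop \<G>) \<and>
    gcomposable \<G> \<beta> \<delta> \<and> gmult \<G> \<beta> \<delta> = (x, k, y) \<and> f \<beta> \<noteq> 0 \<and> f' \<delta> \<noteq> 0}"
  let ?Z = "if k = g \<otimes>\<^bsub>G\<^esub> h then {z. f (x, g, z) \<noteq> 0 \<and> f' (z, h, y) \<noteq> 0} else {}"
  have S: "?S = (\<lambda>z. ((x, g, z), (z, h, y))) ` ?Z"
  proof (intro equalityI subsetI)
    fix \<epsilon> assume \<epsilon>: "\<epsilon> \<in> ?S"
    obtain x1 k1 y1 x2 k2 y2 where e: "\<epsilon> = ((x1, k1, y1), (x2, k2, y2))"
      by (metis surj_pair)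
    have nz: "f (x1, k1, y1) \<noteq> 0" "f' (x2, k2, y2) \<noteq> 0"
      and m: "y1 = x2" "x1 = x" "y2 = y" "k1 \<otimes>\<^bsub>G\<^esub> k2 = k"
      using \<epsilon> by (auto simp: e dr_groupoid_def)
    show "\<epsilon> \<in> (\<lambda>z. ((x, g, z), (z, h, y))) ` ?Z"
      using nz m f[OF nz(1)] f'[OF nz(2)] by (auto simp: e)
  next
    fix \<epsilon> assume "\<epsilon> \<in> (\<lambda>z. ((x, g, z), (z, h, y))) ` ?Z"
    then obtain z where z: "\<epsilon> = ((x, g, z), (z, h, y))" "k = g \<otimes>\<^bsub>G\<^esub> h"
      "f (x, g, z) \<noteq> 0" "f' (z, h, y) \<noteq> 0"
      by (auto split: if_splits)
    then show "\<epsilon> \<in> ?S"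
      using f[OF z(3)] f'[OF z(4)] by (simp add: dr_groupoid_def)
  qed
  have "inj_on (\<lambda>z. ((x, g, z), (z, h, y))) ?Z"
    by (auto simp: inj_on_def)
  then have "convolution \<G> f f' (x, k, y) = (\<Sum>z\<in>?Z. f (x, g, z) * f' (z, h, y))"
    unfolding convolution_def S by (simp add: sum.reindex)
  then show ?thesis
    by simp
qed

lemma finite_common_refinement:
  assumes "finite E" "E \<noteq> {}" and E: "\<And>p q. (p, q) \<in> E \<Longrightarrow> p \<in> carrier P \<and> q \<in> carrier P \<and> quot p q = g"
    and x: "\<And>p q. (p, q) \<in> E \<Longrightarrow> x \<in> dom p"
  shows "\<exists>r t. r \<in> carrier P \<and> t \<in> carrier P \<and> quot r t = g \<and> dom r = (\<Inter>(p, q)\<in>E. dom p) \<and>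
    (\<forall>(p, q)\<in>E. \<exists>s\<in>carrier P. r = p \<otimes> s \<and> t = q \<otimes> s)"
  using assms
proof (induction E rule: finite_ne_induct)
  case (singleton k)
  obtain p q where k: "k = (p, q)"
    by (metis surj_pair)
  have "p \<in> carrier P" "q \<in> carrier P" "quot p q = g"
    using singleton.prems k by auto
  then show ?case
    by (intro exI[of _ p] exI[of _ q]) (auto simp: k intro!: bexI[of _ \<one>])
next
  case (insert k E)
  obtain p q where k: "k = (p, q)"
    by (metis surj_pair)
  have pq: "p \<in> carrier P" "q \<in> carrier P" "quot p q = g" "x \<in> dom p"
    using insert.prems k by auto
  have "\<exists>r t. r \<in> carrier P \<and> t \<in> carrier P \<and> quot r t = g \<and> dom r = (\<Inter>(p, q)\<in>E. dom p) \<and>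
    (\<forall>(p, q)\<in>E. \<exists>s\<in>carrier P. r = p \<otimes> s \<and> t = q \<otimes> s)"
    by (rule insert.IH) (use insert.prems in auto)
  then obtain r t where rt: "r \<in> carrier P" "t \<in> carrier P" "quot r t = g"
    "dom r = (\<Inter>(p, q)\<in>E. dom p)"
    and div: "\<And>p q. (p, q) \<in> E \<Longrightarrow> \<exists>s\<in>carrier P. r = p \<otimes> s \<and> t = q \<otimes> s"
    by (elim exE conjE) (rule that, auto)
  have "x \<in> dom r"
    unfolding rt(4) using insert.prems(2) by auto
  from common_refinement_dom[OF rt(1,2) pq(1,2) _ this pq(4)] rt(3) pq(3)
  obtain u s where us: "u \<in> carrier P" "s \<in> carrier P" "r \<otimes> u = p \<otimes> s" "t \<otimes> u = q \<otimes> s"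
    "dom (r \<otimes> u) = dom r \<inter> dom p"
    by metis
  show ?case
  proof (intro exI conjI)
    show "r \<otimes> u \<in> carrier P" "t \<otimes> u \<in> carrier P"
      using rt(1,2) us(1) by blast+
    show "quot (r \<otimes> u) (t \<otimes> u) = g"
      using quot_mult_right[OF rt(1,2) us(1)] rt(3) by simp
    show "dom (r \<otimes> u) = (\<Inter>(p, q)\<in>insert k E. dom p)"
      using us(5) rt(4) by (auto simp: k)
    show "\<forall>(p, q)\<in>insert k E. \<exists>s\<in>carrier P. r \<otimes> u = p \<otimes> s \<and> t \<otimes> u = q \<otimes> s"
    proof (intro ballI, clarify)
      fix p' q' assume "(p', q') \<in> insert k E"
      then consider "p' = p" "q' = q" | "(p', q') \<in> E"
        using k by auto
      then show "\<exists>s\<in>carrier P. r \<otimes> u = p' \<otimes> s \<and> t \<otimes> u = q' \<otimes> s"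
      proof cases
        case 1
        then show ?thesis
          using us by blast
      next
        case 2
        then obtain v where v: "v \<in> carrier P" "r = p' \<otimes> v" "t = q' \<otimes> v"
          using div by blast
        have "p' \<in> carrier P" "q' \<in> carrier P"
          using insert.prems(1) 2 by blast+
        then show ?thesis
          using v us(1) by (intro bexI[of _ "v \<otimes> u"]) (simp_all add: m_assoc)
      qed
    qed
  qed
qed

text \<open>Points of \<open>X\<close> are sorted by which of the finitely many elements acting in the description of
  \<open>K\<close> are defined at them; on each type a common refinement describes all of \<open>K\<close>.\<close>

lemma cell_decomposition:
  assumes lc: "locally_compact_space X" and td: "totally_disconnected_space X"
    and clopen: "\<And>p. p \<in> carrier P \<Longrightarrow> closedin X (dom p)"
    and K: "compactin T K" "\<And>\<gamma>. \<gamma> \<in> K \<Longrightarrow> fst (snd \<gamma>) = g"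
  obtains \<W> \<Y> :: "'x set set" and F F' :: "'x \<Rightarrow> ('p \<times> 'p) set" and r t :: "('p \<times> 'p) set \<Rightarrow> 'p"
  where "finite \<W>" "pairwise disjnt \<W>" "finite \<Y>" "pairwise disjnt \<Y>"
    "\<forall>W\<in>\<W>. compactin X W \<and> openin X W \<and>
      (\<exists>E. r E \<in> carrier P \<and> t E \<in> carrier P \<and> quot (r E) (t E) = g \<and>
        (\<forall>x\<in>W. F x = E) \<and> W \<subseteq> dom (r E) \<and> inj_on (\<alpha> (r E)) W)"
    "\<forall>Y\<in>\<Y>. compactin X Y \<and> openin X Y \<and>
      (\<exists>E. r E \<in> carrier P \<and> t E \<in> carrier P \<and> quot (r E) (t E) = g \<and>
        (\<forall>y\<in>Y. F' y = E) \<and> Y \<subseteq> dom (t E) \<and> inj_on (\<alpha> (t E)) Y)"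
    "\<forall>x h y. (x, h, y) \<in> K \<longrightarrow>
      x \<in> \<Union>\<W> \<and> y \<in> \<Union>\<Y> \<and> F x = F' y \<and> \<alpha> (r (F x)) x = \<alpha> (t (F' y)) y"
proof -
  let ?D = "\<lambda>(p, q). D (topspace X) p q (topspace X)"
  let ?A = "{(p, q). p \<in> carrier P \<and> q \<in> carrier P \<and> quot p q = g}"
  have KT: "K \<subseteq> topspace T"
    using K(1) compactin_subset_topspace by blast
  have "K \<subseteq> \<Union>(?D ` ?A)"
  proof
    fix \<gamma> assume \<gamma>: "\<gamma> \<in> K"
    obtain x h y where xy: "\<gamma> = (x, h, y)"
      by (metis surj_pair)
    have "(x, h, y) \<in> topspace T"
      using \<gamma> KT xy by blast
    then obtain p q where pq: "p \<in> carrier P" "q \<in> carrier P" "(x, h, y) \<in> D (topspace X) p q (topspace X)"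
      unfolding topspace_T by blast
    moreover have "quot p q = g"
      using pq(3) K(2)[OF \<gamma>] unfolding xy mem_D by simp
    ultimately show "\<gamma> \<in> \<Union>(?D ` ?A)"
      using xy by (intro UN_I[of "(p, q)"]) auto
  qed
  moreover have "\<forall>S\<in>?D ` ?A. openin T S"
    using openin_D by auto
  ultimately obtain \<F> where \<F>: "finite \<F>" "\<F> \<subseteq> ?D ` ?A" "K \<subseteq> \<Union>\<F>"
    using K(1) unfolding compactin_def by meson
  from finite_subset_image[OF \<F>(1,2)]
  obtain S where "S \<subseteq> ?A" "finite S" "\<F> = ?D ` S"
    by (elim exE conjE)
  with \<F>(3) have S: "finite S" "S \<subseteq> ?A" "K \<subseteq> \<Union>(?D ` S)"
    by simp_all
  define F where "F x = {k \<in> S. x \<in> dom (fst k)}" for x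
  define F' where "F' y = {k \<in> S. y \<in> dom (snd k)}" for y
  let ?R = "\<lambda>E r t. r \<in> carrier P \<and> t \<in> carrier P \<and> quot r t = g \<and> dom r = (\<Inter>(p, q)\<in>E. dom p) \<and>
    (\<forall>(p, q)\<in>E. \<exists>s\<in>carrier P. r = p \<otimes> s \<and> t = q \<otimes> s)"
  have "\<exists>r t. E \<noteq> {} \<and> (\<exists>x. F x = E) \<longrightarrow> ?R E r t" for E
  proof (cases "E \<noteq> {} \<and> (\<exists>x. F x = E)")
    case True
    then obtain x where x: "F x = E" "E \<noteq> {}"
      by blast
    have "\<exists>r t. ?R E r t"
    proof (rule finite_common_refinement)
      show "finite E"
        using S(1) x(1) by (auto simp: F_def)
      show "p \<in> carrier P \<and> q \<in> carrier P \<and> quot p q = g" "x \<in> dom p" if "(p, q) \<in> E" for p q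
        using that S(2) x(1) by (auto simp: F_def)
    qed (use x in auto)
    then show ?thesis
      by blast
  qed auto
  then have "\<forall>E. \<exists>r t. E \<noteq> {} \<and> (\<exists>x. F x = E) \<longrightarrow> ?R E r t"
    by (rule allI)
  from choice[OF this] obtain r where
    "\<forall>E. \<exists>t. E \<noteq> {} \<and> (\<exists>x. F x = E) \<longrightarrow> ?R E (r E) t"
    by (elim exE)
  from choice[OF this] obtain t where
    rt': "\<forall>E. E \<noteq> {} \<and> (\<exists>x. F x = E) \<longrightarrow> ?R E (r E) (t E)"
    by (elim exE)
  have rt: "?R E (r E) (t E)" if "E \<noteq> {}" "\<exists>x. F x = E" for E
    by (rule rt'[THEN spec, THEN mp]) (intro conjI that)
  have arrow: "F x \<noteq> {} \<and> F' y = F x \<and> x \<in> dom (r (F x)) \<and> y \<in> dom (t (F x)) \<and>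
      \<alpha> (r (F x)) x = \<alpha> (t (F x)) y" if K': "(x, h, y) \<in> K" for x h y
  proof -
    obtain p q where pq: "(p, q) \<in> S" "(x, h, y) \<in> D (topspace X) p q (topspace X)"
      using S(3) K' by auto
    then have P: "p \<in> carrier P" "q \<in> carrier P" "quot p q = g"
      and xy: "x \<in> dom p" "y \<in> dom q" "\<alpha> p x = \<alpha> q y"
      using S(2) by (auto simp: mem_D)
    have ne: "F x \<noteq> {}" "(p, q) \<in> F x"
      using pq xy by (auto simp: F_def)
    have "x \<in> dom (fst k) \<longleftrightarrow> y \<in> dom (snd k)" if "k \<in> S" for k
      using dom_transfer[OF P(1,2), of "fst k" "snd k" x y] P(3) S(2) that xy by auto
    then have FF: "F' y = F x"
      by (auto simp: F_def F'_def)
    have R: "?R (F x) (r (F x)) (t (F x))"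
      by (rule rt[OF ne(1)]) blast
    have x: "x \<in> dom (r (F x))"
      using R by (auto simp: F_def)
    obtain s where s: "s \<in> carrier P" "r (F x) = p \<otimes> s" "t (F x) = q \<otimes> s"
      using R ne(2) by blast
    have y: "y \<in> dom (t (F x))"
      using x xy dom_mult P(1,2) s by auto
    have "\<alpha> (r (F x)) x = \<alpha> s (\<alpha> p x)"
      using x unfolding s(2) by (rule \<alpha>_mult[OF P(1) s(1)])
    moreover have "\<alpha> (t (F x)) y = \<alpha> s (\<alpha> q y)"
      using y unfolding s(3) by (rule \<alpha>_mult[OF P(2) s(1)])
    ultimately show ?thesis
      using ne FF x y xy(3) by simp
  qed
  have type_open: "openin X {x \<in> topspace X. {k \<in> S. x \<in> dom (f k)} = E}"
    if "\<And>k. k \<in> S \<Longrightarrow> f k \<in> carrier P" for f :: "'p \<times> 'p \<Rightarrow> 'p" and E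
  proof (cases "E \<subseteq> S")
    case True
    have "openin X ((\<Inter>k\<in>S. if k \<in> E then dom (f k) else topspace X - dom (f k)) \<inter> topspace X)"
      using S(1) that clopen dom_open by (intro openin_INT) auto
    moreover have "(\<Inter>k\<in>S. if k \<in> E then dom (f k) else topspace X - dom (f k)) \<inter> topspace X =
        {x \<in> topspace X. {k \<in> S. x \<in> dom (f k)} = E}"
      using True by (auto split: if_splits)
    ultimately show ?thesis
      by simp
  next
    case False
    then have "{x \<in> topspace X. {k \<in> S. x \<in> dom (f k)} = E} = {}"
      by auto
    then show ?thesis
      by (simp only: openin_empty)
  qed
  have F_open: "openin X {x \<in> topspace X. F x = E}" for E
    unfolding F_def using S(2) by (intro type_open) auto
  have F'_open: "openin X {x \<in> topspace X. F' x = E}" for E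
    unfolding F'_def using S(2) by (intro type_open) auto
  let ?QW = "\<lambda>W. \<exists>E. r E \<in> carrier P \<and> t E \<in> carrier P \<and> quot (r E) (t E) = g \<and>
        (\<forall>x\<in>W. F x = E) \<and> W \<subseteq> dom (r E) \<and> inj_on (\<alpha> (r E)) W"
  let ?QY = "\<lambda>Y. \<exists>E. r E \<in> carrier P \<and> t E \<in> carrier P \<and> quot (r E) (t E) = g \<and>
        (\<forall>y\<in>Y. F' y = E) \<and> Y \<subseteq> dom (t E) \<and> inj_on (\<alpha> (t E)) Y"
  have nbhdW: "\<exists>W. openin X W \<and> x \<in> W \<and> ?QW W" if xK: "x \<in> fst ` K" for x
  proof -
    obtain h y where xy: "(x, h, y) \<in> K"
      using xK by force
    note a = arrow[OF xy]
    have R: "?R (F x) (r (F x)) (t (F x))"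
      by (rule rt) (use a in auto)
    have "r (F x) \<in> carrier P" "x \<in> dom (r (F x))"
      using a R by simp_all
    from locally_injective[OF this]
    obtain N where N: "openin X N" "x \<in> N" "N \<subseteq> dom (r (F x))" "inj_on (\<alpha> (r (F x))) N" .
    have "openin X (N \<inter> {x' \<in> topspace X. F x' = F x})"
      using N(1) F_open by blast
    moreover have "x \<in> N \<inter> {x' \<in> topspace X. F x' = F x}"
      using N openin_subset by blast
    moreover have "?QW (N \<inter> {x' \<in> topspace X. F x' = F x})"
      using R N(3,4) by (intro exI[of _ "F x"]) (auto intro: inj_on_subset)
    ultimately show ?thesis
      by blast
  qed
  have cptW: "compactin X (fst ` K)"
    using K(1) continuous_map_fst by (rule image_compactin)
  have hereditaryW: "?QW V" if U: "?QW U" and V: "V \<subseteq> U" for U V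
  proof -
    from U obtain E where E: "r E \<in> carrier P \<and> t E \<in> carrier P \<and> quot (r E) (t E) = g"
      "\<forall>x\<in>U. F x = E" "U \<subseteq> dom (r E)" "inj_on (\<alpha> (r E)) U"
      by blast
    show ?thesis
      by (rule exI[of _ E]) (use E V inj_on_subset[OF E(4) V] in auto)
  qed
  from disjoint_compact_open_cover[where Q = ?QW, OF lc Hausdorff td cptW nbhdW hereditaryW]
  obtain \<W> where \<W>: "finite \<W>" "pairwise disjnt \<W>" "fst ` K \<subseteq> \<Union>\<W>"
    "\<forall>W\<in>\<W>. compactin X W \<and> openin X W \<and> ?QW W" .
  have nbhdY: "\<exists>Y. openin X Y \<and> y \<in> Y \<and> ?QY Y" if yK: "y \<in> (\<lambda>\<gamma>. snd (snd \<gamma>)) ` K" for y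
  proof -
    obtain x h where xy: "(x, h, y) \<in> K"
      using yK by force
    note a = arrow[OF xy]
    have R: "?R (F x) (r (F x)) (t (F x))"
      by (rule rt) (use a in auto)
    have "t (F x) \<in> carrier P" "y \<in> dom (t (F x))"
      using a R by simp_all
    from locally_injective[OF this]
    obtain N where N: "openin X N" "y \<in> N" "N \<subseteq> dom (t (F x))" "inj_on (\<alpha> (t (F x))) N" .
    have "openin X (N \<inter> {y' \<in> topspace X. F' y' = F x})"
      using N(1) F'_open by blast
    moreover have "y \<in> N \<inter> {y' \<in> topspace X. F' y' = F x}"
      using N a openin_subset by blast
    moreover have "?QY (N \<inter> {y' \<in> topspace X. F' y' = F x})"
      using R N(3,4) by (intro exI[of _ "F x"]) (auto intro: inj_on_subset)
    ultimately show ?thesis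
      by blast
  qed
  have cptY: "compactin X ((\<lambda>\<gamma>. snd (snd \<gamma>)) ` K)"
    using K(1) continuous_map_snd by (rule image_compactin)
  have hereditaryY: "?QY V" if U: "?QY U" and V: "V \<subseteq> U" for U V
  proof -
    from U obtain E where E: "r E \<in> carrier P \<and> t E \<in> carrier P \<and> quot (r E) (t E) = g"
      "\<forall>y\<in>U. F' y = E" "U \<subseteq> dom (t E)" "inj_on (\<alpha> (t E)) U"
      by blast
    show ?thesis
      by (rule exI[of _ E]) (use E V inj_on_subset[OF E(4) V] in auto)
  qed
  from disjoint_compact_open_cover[where Q = ?QY, OF lc Hausdorff td cptY nbhdY hereditaryY]
  obtain \<Y> where \<Y>: "finite \<Y>" "pairwise disjnt \<Y>" "(\<lambda>\<gamma>. snd (snd \<gamma>)) ` K \<subseteq> \<Union>\<Y>"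
    "\<forall>Y\<in>\<Y>. compactin X Y \<and> openin X Y \<and> ?QY Y" .
  show thesis
  proof (rule that[OF \<W>(1,2) \<Y>(1,2) \<W>(4) \<Y>(4)], intro allI impI)
    fix x h y assume xy: "(x, h, y) \<in> K"
    have "x \<in> \<Union>\<W>"
      using \<W>(3) imageI[OF xy, of fst] by auto
    moreover have "y \<in> \<Union>\<Y>"
      using \<Y>(3) imageI[OF xy, of "\<lambda>\<gamma>. snd (snd \<gamma>)"] by auto
    ultimately show "x \<in> \<Union>\<W> \<and> y \<in> \<Union>\<Y> \<and> F x = F' y \<and> \<alpha> (r (F x)) x = \<alpha> (t (F' y)) y"
      using arrow[OF xy] by auto
  qed
qed

end

subsection \<open>Quasi-inverses of homogeneous elements\<close>

locale dr_cells = dr_action X P act G \<iota>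
  for X :: "'x topology" and P :: "('p, 'm) monoid_scheme" (structure)
    and act :: "'x \<Rightarrow> 'p \<Rightarrow> 'x option" and G :: "('g, 'n) monoid_scheme" and \<iota> :: "'p \<Rightarrow> 'g" +
  fixes g :: 'g and a :: "'x \<times> 'g \<times> 'x \<Rightarrow> 'r::{ring, monoid_mult}"
    and \<W> \<Y> :: "'x set set" and F F' :: "'x \<Rightarrow> 'e" and r t :: "'e \<Rightarrow> 'p"
    and N :: "('x set \<times> 'x set \<Rightarrow> 'r) \<Rightarrow> 'x set \<Rightarrow> 'x set \<Rightarrow> 'r"
  assumes g: "g \<in> carrier G"
    and finite_\<W>: "finite \<W>" and disjoint_\<W>: "pairwise disjnt \<W>"
    and finite_\<Y>: "finite \<Y>" and disjoint_\<Y>: "pairwise disjnt \<Y>"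
    and cell_\<W>: "\<And>W. W \<in> \<W> \<Longrightarrow> compactin X W \<and> openin X W \<and>
      (\<exists>E. r E \<in> carrier P \<and> t E \<in> carrier P \<and> quot (r E) (t E) = g \<and>
        (\<forall>x\<in>W. F x = E) \<and> W \<subseteq> dom (r E) \<and> inj_on (\<alpha> (r E)) W)"
    and cell_\<Y>: "\<And>Y. Y \<in> \<Y> \<Longrightarrow> compactin X Y \<and> openin X Y \<and>
      (\<exists>E. r E \<in> carrier P \<and> t E \<in> carrier P \<and> quot (r E) (t E) = g \<and>
        (\<forall>y\<in>Y. F' y = E) \<and> Y \<subseteq> dom (t E) \<and> inj_on (\<alpha> (t E)) Y)"
    and a_support: "\<And>x h y. a (x, h, y) \<noteq> 0 \<Longrightarrow> (x, h, y) \<in> topspace T \<and> h = g \<and>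
      x \<in> \<Union>\<W> \<and> y \<in> \<Union>\<Y> \<and> F x = F' y \<and> \<alpha> (r (F x)) x = \<alpha> (t (F' y)) y"
    and finite_range_a: "finite (range a)"
    and a_open: "\<And>R. openin T {\<gamma> \<in> topspace T. a \<gamma> \<in> R}"
    and N: "\<And>M W Y. W \<in> \<W> \<Longrightarrow> Y \<in> \<Y> \<Longrightarrow>
      mat_mult \<W> (mat_mult \<Y> (\<lambda>i j. M (i, j)) (N M)) (\<lambda>i j. M (i, j)) W Y = M (W, Y)"
begin

definition \<phi> :: "'x \<Rightarrow> 'e \<times> 'x" where
  "\<phi> x = (F x, \<alpha> (r (F x)) x)"

definition \<psi> :: "'x \<Rightarrow> 'e \<times> 'x" where
  "\<psi> y = (F' y, \<alpha> (t (F' y)) y)"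

definition mat :: "'e \<times> 'x \<Rightarrow> 'x set \<times> 'x set \<Rightarrow> 'r" where
  "mat z = (\<lambda>(W, Y).
     if W \<in> \<W> \<and> Y \<in> \<Y> \<and> z \<in> \<phi> ` W \<and> z \<in> \<psi> ` Y
     then a (inv_into W \<phi> z, g, inv_into Y \<psi> z) else 0)"

lemma \<W>_point:
  assumes "W \<in> \<W>" "x \<in> W"
  shows "r (F x) \<in> carrier P" "t (F x) \<in> carrier P" "quot (r (F x)) (t (F x)) = g"
    "W \<subseteq> dom (r (F x))" "inj_on (\<alpha> (r (F x))) W" "x' \<in> W \<Longrightarrow> F x' = F x"
  using cell_\<W>[OF assms(1)] assms(2) by auto

lemma \<Y>_point:
  assumes "Y \<in> \<Y>" "y \<in> Y"
  shows "r (F' y) \<in> carrier P" "t (F' y) \<in> carrier P" "quot (r (F' y)) (t (F' y)) = g"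
    "Y \<subseteq> dom (t (F' y))" "inj_on (\<alpha> (t (F' y))) Y" "y' \<in> Y \<Longrightarrow> F' y' = F' y"
  using cell_\<Y>[OF assms(1)] assms(2) by auto

lemma inj_on_\<phi>: "W \<in> \<W> \<Longrightarrow> inj_on \<phi> W"
proof (rule inj_onI)
  fix x x' assume A: "W \<in> \<W>" "x \<in> W" "x' \<in> W" "\<phi> x = \<phi> x'"
  then have "\<alpha> (r (F x)) x = \<alpha> (r (F x)) x'"
    by (auto simp: \<phi>_def)
  then show "x = x'"
    using inj_onD[OF \<W>_point(5)[OF A(1,2)] _ A(2,3)] by simp
qed

lemma inj_on_\<psi>: "Y \<in> \<Y> \<Longrightarrow> inj_on \<psi> Y"
proof (rule inj_onI)
  fix x x' assume A: "Y \<in> \<Y>" "x \<in> Y" "x' \<in> Y" "\<psi> x = \<psi> x'"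
  then have "\<alpha> (t (F' x)) x = \<alpha> (t (F' x)) x'"
    by (auto simp: \<psi>_def)
  then show "x = x'"
    using inj_onD[OF \<Y>_point(5)[OF A(1,2)] _ A(2,3)] by simp
qed

lemma mat_eq:
  assumes "W \<in> \<W>" "Y \<in> \<Y>" "x \<in> W" "y \<in> Y" "\<phi> x = z" "\<psi> y = z"
  shows "mat z (W, Y) = a (x, g, y)"
proof -
  have "inv_into W \<phi> z = x" "inv_into Y \<psi> z = y"
    using assms inj_on_\<phi> inj_on_\<psi> by (auto intro: inv_into_f_eq)
  moreover have "z \<in> \<phi> ` W" "z \<in> \<psi> ` Y"
    using imageI[OF assms(3), of \<phi>] imageI[OF assms(4), of \<psi>] assms(5,6) by simp_all
  ultimately show ?thesis
    using assms(1,2) by (simp add: mat_def)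
qed

lemma mat_nonzero:
  assumes "mat z (W, Y) \<noteq> 0"
  obtains x y where "W \<in> \<W>" "Y \<in> \<Y>" "x \<in> W" "y \<in> Y" "\<phi> x = z" "\<psi> y = z"
  using assms by (auto simp: mat_def split: if_splits)

lemma mat_outside: "i \<notin> \<W> \<times> \<Y> \<Longrightarrow> mat z i = 0"
  by (cases i) (auto simp: mat_def)

lemma finite_range_mat: "finite (range mat)"
proof (rule finite_subset)
  show "range mat \<subseteq>
      {f. \<forall>i. (i \<in> \<W> \<times> \<Y> \<longrightarrow> f i \<in> insert 0 (range a)) \<and> (i \<notin> \<W> \<times> \<Y> \<longrightarrow> f i = 0)}"
    by (force simp: mat_def split: prod.split)
  show "finite {f. \<forall>i. (i \<in> \<W> \<times> \<Y> \<longrightarrow> f i \<in> insert 0 (range a)) \<and> (i \<notin> \<W> \<times> \<Y> \<longrightarrow> f i = 0)}"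
    using finite_\<W> finite_\<Y> finite_range_a by (intro finite_set_of_finite_funs) auto
qed

lemma arrow_in_D:
  assumes "W \<in> \<W>" "Y \<in> \<Y>" "x \<in> W" "y \<in> Y" "\<phi> x = \<psi> y"
  shows "(x, g, y) \<in> D W (r (F x)) (t (F x)) Y"
proof -
  have "F' y = F x" "\<alpha> (r (F x)) x = \<alpha> (t (F x)) y"
    using assms(5) by (auto simp: \<phi>_def \<psi>_def)
  moreover have "x \<in> dom (r (F x))" "y \<in> dom (t (F' y))"
    using \<W>_point(4)[OF assms(1,3)] \<Y>_point(4)[OF assms(2,4)] assms(3,4) by auto
  ultimately show ?thesis
    using assms(3,4) \<W>_point(3)[OF assms(1,3)] by (simp add: mem_D)
qed

lemma inverse_arrow_in_D:
  assumes "W \<in> \<W>" "Y \<in> \<Y>" "x \<in> W" "y \<in> Y" "\<phi> x = \<psi> y"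
  shows "(y, inv\<^bsub>G\<^esub> g, x) \<in> D Y (t (F x)) (r (F x)) W"
  using arrow_in_D[OF assms] inv_quot[OF \<W>_point(1,2)[OF assms(1,3)]] \<W>_point(3)[OF assms(1,3)]
  by (auto simp: mem_D)

lemma openin_mat_level:
  assumes W: "W \<in> \<W>" and W': "W' \<in> \<W>" and Y': "Y' \<in> \<Y>"
  shows "openin X {x \<in> W. mat (\<phi> x) (W', Y') \<in> R}"
proof -
  have nonzero: "openin X {x \<in> W. mat (\<phi> x) (W', Y') \<in> R} \<and> openin X {x \<in> W. mat (\<phi> x) (W', Y') \<notin> R}"
    if R: "0 \<notin> R" for R
  proof (cases "{x \<in> W. mat (\<phi> x) (W', Y') \<in> R} = {}")
    case True
    then have "{x \<in> W. mat (\<phi> x) (W', Y') \<notin> R} = W"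
      by blast
    then show ?thesis
      using True cell_\<W>[OF W] by (simp only: openin_empty)
  next
    case False
    then obtain x0 where x0: "x0 \<in> W" "mat (\<phi> x0) (W', Y') \<in> R"
      by blast
    then obtain x1 y1 where 1: "x1 \<in> W'" "y1 \<in> Y'" "\<phi> x1 = \<phi> x0" "\<psi> y1 = \<phi> x0"
      using R mat_nonzero by metis
    define p where "p = r (F x0)"
    define q where "q = t (F x0)"
    have F1: "F x1 = F x0" "F' y1 = F x0"
      using 1(3,4) by (auto simp: \<phi>_def \<psi>_def)
    have pq: "p \<in> carrier P" "q \<in> carrier P" "quot p q = g"
      using \<W>_point[OF W x0(1)] by (auto simp: p_def q_def)
    have Wp: "W \<subseteq> dom p" "W' \<subseteq> dom p" "inj_on (\<alpha> p) W'" "Y' \<subseteq> dom q" "inj_on (\<alpha> q) Y'"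
      using \<W>_point(4)[OF W x0(1)] \<W>_point(4,5)[OF W' 1(1)] \<Y>_point(4,5)[OF Y' 1(2)]
      by (auto simp: p_def q_def F1)
    have \<phi>W: "\<phi> x = (F x0, \<alpha> p x)" if "x \<in> W" for x
      using \<W>_point(6)[OF W x0(1) that] by (simp add: \<phi>_def p_def)
    have \<phi>W': "\<phi> x = (F x0, \<alpha> p x)" if "x \<in> W'" for x
      using \<W>_point(6)[OF W' 1(1) that] F1 by (simp add: \<phi>_def p_def)
    have \<psi>Y': "\<psi> y = (F x0, \<alpha> q y)" if "y \<in> Y'" for y
      using \<Y>_point(6)[OF Y' 1(2) that] F1 by (simp add: \<psi>_def q_def)
    let ?O = "{\<gamma> \<in> D W' p q Y'. a \<gamma> \<in> R}"
    have cD: "compactin T (D W' p q Y')" and oD: "openin T (D W' p q Y')"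
      using cell_\<W>[OF W'] cell_\<Y>[OF Y'] pq Wp by (auto intro!: compactin_D openin_D)
    have "?O = D W' p q Y' \<inter> {\<gamma> \<in> topspace T. a \<gamma> \<in> R}"
      using openin_subset[OF oD] by auto
    moreover have "openin T (D W' p q Y' \<inter> {\<gamma> \<in> topspace T. a \<gamma> \<in> R})"
      by (intro openin_Int oD a_open)
    ultimately have oO: "openin T ?O"
      by (simp only:)
    have "?O = D W' p q Y' \<inter> (topspace T - {\<gamma> \<in> topspace T. a \<gamma> \<in> - R})"
      using openin_subset[OF oD] by auto
    moreover have "compactin T (D W' p q Y' \<inter> (topspace T - {\<gamma> \<in> topspace T. a \<gamma> \<in> - R}))"
      using a_open[of "- R"] by (intro compact_Int_closedin cD) auto
    ultimately have cO: "compactin T ?O"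
      by simp
    let ?V = "\<alpha> p ` fst ` ?O"
    have sub: "fst ` ?O \<subseteq> dom p"
      using Wp(2) by (auto simp: mem_D)
    have oV: "openin X ?V"
      using openin_fst_image[OF oO] sub by (rule openin_image[OF pq(1)])
    have "compactin X ?V"
      using image_compactin[OF cO continuous_map_fst] sub by (rule compactin_image[OF pq(1)])
    then have cV: "closedin X ?V"
      by (rule compactin_imp_closedin[OF Hausdorff])
    have eq: "mat (\<phi> x) (W', Y') \<in> R \<longleftrightarrow> \<alpha> p x \<in> ?V" if x: "x \<in> W" for x
    proof
      assume m: "mat (\<phi> x) (W', Y') \<in> R"
      then obtain x' y' where x'y': "x' \<in> W'" "y' \<in> Y'" "\<phi> x' = \<phi> x" "\<psi> y' = \<phi> x"
        using R mat_nonzero by metis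
      have "mat (\<phi> x) (W', Y') = a (x', g, y')"
        by (rule mat_eq[OF W' Y' x'y'])
      moreover have "(x', g, y') \<in> D W' p q Y'"
        using arrow_in_D[OF W' Y' x'y'(1,2)] x'y' \<phi>W[OF x] \<phi>W'[OF x'y'(1)]
        by (auto simp: p_def q_def \<phi>_def)
      ultimately have "x' \<in> fst ` ?O"
        using m by force
      moreover have "\<alpha> p x = \<alpha> p x'"
        using x'y'(3) \<phi>W[OF x] \<phi>W'[OF x'y'(1)] by simp
      ultimately show "\<alpha> p x \<in> ?V"
        by blast
    next
      assume "\<alpha> p x \<in> ?V"
      then obtain x' h y' where O: "(x', h, y') \<in> ?O" "\<alpha> p x = \<alpha> p x'"
        by force
      then have xy: "x' \<in> W'" "y' \<in> Y'" "h = g" "\<alpha> p x' = \<alpha> q y'" "a (x', h, y') \<in> R"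
        using pq(3) by (auto simp: mem_D)
      have "\<phi> x' = \<phi> x" "\<psi> y' = \<phi> x"
        using \<phi>W[OF x] \<phi>W'[OF xy(1)] \<psi>Y'[OF xy(2)] O(2) xy(4) by auto
      then show "mat (\<phi> x) (W', Y') \<in> R"
        using mat_eq[OF W' Y' xy(1,2)] xy(3,5) by simp
    qed
    have "{x \<in> W. mat (\<phi> x) (W', Y') \<in> R} = W \<inter> {x \<in> dom p. \<alpha> p x \<in> ?V}"
      using eq Wp(1) by blast
    moreover have "{x \<in> W. mat (\<phi> x) (W', Y') \<notin> R} = W \<inter> {x \<in> dom p. \<alpha> p x \<in> topspace X - ?V}"
      using eq Wp(1) \<alpha>_in_topspace[OF pq(1)] by blast
    moreover have "openin X (W \<inter> {x \<in> dom p. \<alpha> p x \<in> ?V})"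
      using cell_\<W>[OF W] openin_preimage[OF pq(1) oV] by blast
    moreover have "openin X (W \<inter> {x \<in> dom p. \<alpha> p x \<in> topspace X - ?V})"
      using cell_\<W>[OF W] cV by (intro openin_Int openin_preimage[OF pq(1)]) auto
    ultimately show ?thesis
      by (simp only:)
  qed
  show ?thesis
  proof (cases "0 \<in> R")
    case True
    have "{x \<in> W. mat (\<phi> x) (W', Y') \<notin> - R} = {x \<in> W. mat (\<phi> x) (W', Y') \<in> R}"
      by blast
    with nonzero[of "- R"] True show ?thesis
      by simp
  qed (use nonzero in blast)
qed

lemma compact_open_mat_level:
  assumes W: "W \<in> \<W>" and ne: "\<Y> \<noteq> {}"
  shows "compactin X {x \<in> W. mat (\<phi> x) = mat z}" "openin X {x \<in> W. mat (\<phi> x) = mat z}"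
proof -
  let ?I = "\<W> \<times> \<Y>"
  have I: "finite ?I" "?I \<noteq> {}"
    using finite_\<W> finite_\<Y> W ne by auto
  have "mat (\<phi> x) = mat z \<longleftrightarrow> (\<forall>i\<in>?I. mat (\<phi> x) i = mat z i)" for x
  proof
    assume *: "\<forall>i\<in>?I. mat (\<phi> x) i = mat z i"
    show "mat (\<phi> x) = mat z"
    proof
      fix i show "mat (\<phi> x) i = mat z i"
      proof (cases "i \<in> ?I")
        case True
        with * show ?thesis
          by (rule bspec)
      qed (simp add: mat_outside)
    qed
  qed auto
  then have eq: "{x \<in> W. mat (\<phi> x) = mat z} = (\<Inter>i\<in>?I. {x \<in> W. mat (\<phi> x) i \<in> {mat z i}})"
    "{x \<in> W. mat (\<phi> x) = mat z} = W \<inter> (topspace X - (\<Union>i\<in>?I. {x \<in> W. mat (\<phi> x) i \<in> - {mat z i}}))"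
    using I(2) openin_subset[of X W] cell_\<W>[OF W] by auto
  show "openin X {x \<in> W. mat (\<phi> x) = mat z}"
    unfolding eq(1) by (intro openin_INT2 I) (use openin_mat_level[OF W] in blast)
  have "openin X (\<Union>i\<in>?I. {x \<in> W. mat (\<phi> x) i \<in> - {mat z i}})"
    using openin_mat_level[OF W] by (intro openin_Union) blast
  then show "compactin X {x \<in> W. mat (\<phi> x) = mat z}"
    unfolding eq(2) using cell_\<W>[OF W] by (intro compact_Int_closedin) auto
qed

definition piece :: "'x set \<Rightarrow> 'x set \<Rightarrow> ('x set \<times> 'x set \<Rightarrow> 'r) \<Rightarrow> ('x \<times> 'g \<times> 'x) set" where
  "piece W Y M = {(y, inv\<^bsub>G\<^esub> g, x) | x y. x \<in> W \<and> y \<in> Y \<and> \<phi> x = \<psi> y \<and> mat (\<phi> x) = M}"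

definition b :: "'x \<times> 'g \<times> 'x \<Rightarrow> 'r" where
  "b = (\<lambda>\<gamma>. \<Sum>(W, Y, M)\<in>\<W> \<times> \<Y> \<times> range mat. N M Y W * char_fun (piece W Y M) \<gamma>)"

lemma compact_open_bisection_piece:
  assumes W: "W \<in> \<W>" and Y: "Y \<in> \<Y>" and M: "M \<in> range mat"
  shows "compact_open_bisection \<G> (piece W Y M)"
proof (cases "piece W Y M = {}")
  case True
  then show ?thesis
    by (simp add: compact_open_bisectionI)
next
  case False
  then obtain x0 y0 where 0: "x0 \<in> W" "y0 \<in> Y" "\<phi> x0 = \<psi> y0"
    by (auto simp: piece_def)
  let ?V = "{x \<in> W. mat (\<phi> x) = M}"
  define p where "p = r (F x0)"
  define q where "q = t (F x0)"
  have F0: "F' y0 = F x0"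
    using 0 by (simp add: \<phi>_def \<psi>_def)
  have pq: "p \<in> carrier P" "q \<in> carrier P" "quot p q = g"
    using \<W>_point[OF W 0(1)] by (auto simp: p_def q_def)
  have Wp: "W \<subseteq> dom p" "inj_on (\<alpha> p) W" "Y \<subseteq> dom q" "inj_on (\<alpha> q) Y"
    using \<W>_point(4,5)[OF W 0(1)] \<Y>_point(4,5)[OF Y 0(2)] by (auto simp: p_def q_def F0)
  have \<phi>W: "\<phi> x = (F x0, \<alpha> p x)" if "x \<in> W" for x
    using \<W>_point(6)[OF W 0(1) that] by (simp add: \<phi>_def p_def)
  have \<psi>Y: "\<psi> y = (F x0, \<alpha> q y)" if "y \<in> Y" for y
    using \<Y>_point(6)[OF Y 0(2) that] F0 by (simp add: \<psi>_def q_def)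
  have inv: "quot q p = inv\<^bsub>G\<^esub> g"
    using inv_quot[OF pq(1,2)] pq(3) by simp
  have "piece W Y M = D Y q p ?V"
  proof (intro equalityI subsetI)
    fix \<gamma> assume "\<gamma> \<in> piece W Y M"
    then obtain x y where "\<gamma> = (y, inv\<^bsub>G\<^esub> g, x)" "x \<in> W" "y \<in> Y" "\<phi> x = \<psi> y" "mat (\<phi> x) = M"
      by (auto simp: piece_def)
    then show "\<gamma> \<in> D Y q p ?V"
      using Wp inv \<phi>W[of x] \<psi>Y[of y] by (auto simp: mem_D)
  next
    fix \<gamma> assume \<gamma>: "\<gamma> \<in> D Y q p ?V"
    obtain y h x where yx: "\<gamma> = (y, h, x)"
      by (metis surj_pair)
    then have "h = inv\<^bsub>G\<^esub> g" "y \<in> Y" "x \<in> W" "mat (\<phi> x) = M" "\<alpha> q y = \<alpha> p x"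
      using \<gamma> inv by (auto simp: mem_D)
    then show "\<gamma> \<in> piece W Y M"
      using \<phi>W[of x] \<psi>Y[of y] by (auto simp: piece_def yx)
  qed
  moreover have "compactin X ?V" "openin X ?V"
    using compact_open_mat_level[OF W] M Y by auto
  moreover have "?V \<subseteq> dom p" "inj_on (\<alpha> p) ?V"
    using Wp by (auto intro: inj_on_subset)
  ultimately show ?thesis
    using cell_\<Y>[OF Y] Wp(3,4) by (auto intro!: compact_open_bisection_D[OF pq(2,1)])
qed

lemma b_in_groupoid_algebra: "b \<in> groupoid_algebra \<G>"
  unfolding b_def groupoid_algebra_def split_def
proof (rule left_span_sum)
  show "finite (\<W> \<times> \<Y> \<times> range mat)"
    using finite_\<W> finite_\<Y> finite_range_mat by simp
  fix i assume "i \<in> \<W> \<times> \<Y> \<times> range mat"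
  then have "compact_open_bisection \<G> (piece (fst i) (fst (snd i)) (snd (snd i)))"
    by (auto intro!: compact_open_bisection_piece)
  then show "(\<lambda>\<gamma>. N (snd (snd i)) (fst (snd i)) (fst i) *
      char_fun (piece (fst i) (fst (snd i)) (snd (snd i))) \<gamma>)
    \<in> left_span {char_fun U | U. compact_open_bisection \<G> U}"
    by (intro left_span_scale) blast
qed

lemma b_eq:
  assumes "W \<in> \<W>" "Y \<in> \<Y>" "x \<in> W" "y \<in> Y" "\<phi> x = \<psi> y"
  shows "b (y, inv\<^bsub>G\<^esub> g, x) = N (mat (\<phi> x)) Y W"
proof -
  let ?i = "(W, Y, mat (\<phi> x))"
  have fin: "finite (\<W> \<times> \<Y> \<times> range mat)"
    using finite_\<W> finite_\<Y> finite_range_mat by simp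
  have W: "W' = W" if "W' \<in> \<W>" "x \<in> W'" for W'
    using disjoint_\<W> that assms(1,3) by (auto simp: pairwise_def disjnt_iff)
  have Y: "Y' = Y" if "Y' \<in> \<Y>" "y \<in> Y'" for Y'
    using disjoint_\<Y> that assms(2,4) by (auto simp: pairwise_def disjnt_iff)
  have piece: "(y, inv\<^bsub>G\<^esub> g, x) \<in> piece W' Y' M \<longleftrightarrow> (W', Y', M) = ?i"
    if "W' \<in> \<W>" "Y' \<in> \<Y>" for W' Y' M
  proof -
    have "(y, inv\<^bsub>G\<^esub> g, x) \<in> piece W' Y' M \<longleftrightarrow> x \<in> W' \<and> y \<in> Y' \<and> mat (\<phi> x) = M"
      using assms(5) by (auto simp: piece_def)
    then show ?thesis
      using W[OF that(1)] Y[OF that(2)] assms(3,4) by auto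
  qed
  have "b (y, inv\<^bsub>G\<^esub> g, x) =
      (\<Sum>i\<in>\<W> \<times> \<Y> \<times> range mat. if i = ?i then N (mat (\<phi> x)) Y W else 0)"
    unfolding b_def
  proof (rule sum.cong[OF refl])
    fix i assume "i \<in> \<W> \<times> \<Y> \<times> range mat"
    then obtain W' Y' M where i: "i = (W', Y', M)" "W' \<in> \<W>" "Y' \<in> \<Y>"
      by auto
    show "(case i of (W, Y, M) \<Rightarrow> N M Y W * char_fun (piece W Y M) (y, inv\<^bsub>G\<^esub> g, x)) =
        (if i = ?i then N (mat (\<phi> x)) Y W else 0)"
      using piece[OF i(2,3), of M] unfolding i(1) by (simp add: char_fun_def)
  qed
  then show ?thesis
    using assms fin by (simp add: sum.delta)
qed

lemma b_nonzero:
  assumes "b (y, h, x) \<noteq> 0"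
  obtains W Y where "W \<in> \<W>" "Y \<in> \<Y>" "x \<in> W" "y \<in> Y" "\<phi> x = \<psi> y" "h = inv\<^bsub>G\<^esub> g"
proof -
  obtain i where "i \<in> \<W> \<times> \<Y> \<times> range mat"
    "(case i of (W, Y, M) \<Rightarrow> N M Y W * char_fun (piece W Y M) (y, h, x)) \<noteq> 0"
    using assms unfolding b_def by (meson sum.not_neutral_contains_not_neutral)
  then obtain W Y M where "W \<in> \<W>" "Y \<in> \<Y>" "(y, h, x) \<in> piece W Y M"
    by (auto simp: char_fun_def split: if_splits)
  then show thesis
    using that by (auto simp: piece_def)
qed

lemma b_support:
  assumes "b (y, h, x) \<noteq> 0"
  shows "(y, h, x) \<in> topspace T \<and> h = inv\<^bsub>G\<^esub> g"
proof -
  obtain W Y where *: "W \<in> \<W>" "Y \<in> \<Y>" "x \<in> W" "y \<in> Y" "\<phi> x = \<psi> y" "h = inv\<^bsub>G\<^esub> g"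
    using b_nonzero[OF assms] by metis
  have "(y, inv\<^bsub>G\<^esub> g, x) \<in> topspace T"
    using inverse_arrow_in_D[OF *(1-5)] D_subset_topspace[OF \<W>_point(2,1)[OF *(1,3)]] by blast
  with *(6) show ?thesis
    by simp
qed

lemma a_support':
  assumes "a (x, h, y) \<noteq> 0"
  obtains W Y where "W \<in> \<W>" "Y \<in> \<Y>" "x \<in> W" "y \<in> Y" "\<phi> x = \<psi> y"
  using a_support[OF assms] that by (auto simp: \<phi>_def \<psi>_def)

lemma convolution_ab:
  assumes W: "W \<in> \<W>" "x \<in> W" and W': "W' \<in> \<W>" "x' \<in> W'" and z: "\<phi> x = z" "\<phi> x' = z"
  shows "convolution \<G> a b (x, \<one>\<^bsub>G\<^esub>, x') = (\<Sum>Y\<in>\<Y>. mat z (W, Y) * N (mat z) Y W')"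
proof -
  let ?S = "{y. a (x, g, y) \<noteq> 0 \<and> b (y, inv\<^bsub>G\<^esub> g, x') \<noteq> 0}"
  have "convolution \<G> a b (x, \<one>\<^bsub>G\<^esub>, x') = (\<Sum>y\<in>?S. a (x, g, y) * b (y, inv\<^bsub>G\<^esub> g, x'))"
    using convolution_homogeneous[of a g b "inv\<^bsub>G\<^esub> g"] a_support b_support g by simp
  also have "\<dots> = (\<Sum>Y\<in>\<Y>. mat z (W, Y) * N (mat z) Y W')"
  proof (rule sum_fibre_eq_sum_cells[OF finite_\<Y> disjoint_\<Y> inj_on_\<psi>])
    show "?S \<subseteq> {y \<in> \<Union>\<Y>. \<psi> y = z}"
    proof
      fix y assume "y \<in> ?S"
      then have "a (x, g, y) \<noteq> 0"
        by simp
      from a_support'[OF this] obtain Y where "Y \<in> \<Y>" "y \<in> Y" "\<phi> x = \<psi> y" .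
      then show "y \<in> {y \<in> \<Union>\<Y>. \<psi> y = z}"
        using z(1) by auto
    qed
    fix Y assume Y: "Y \<in> \<Y>"
    show "mat z (W, Y) * N (mat z) Y W' =
        (if y \<in> ?S then a (x, g, y) * b (y, inv\<^bsub>G\<^esub> g, x') else 0)" if y: "y \<in> Y" "\<psi> y = z" for y
    proof -
      have "mat z (W, Y) = a (x, g, y)"
        using mat_eq W Y y z by blast
      moreover have "b (y, inv\<^bsub>G\<^esub> g, x') = N (mat z) Y W'"
        using b_eq[OF W'(1) Y W'(2) y(1)] y z by simp
      ultimately show ?thesis
        by auto
    qed
    show "mat z (W, Y) * N (mat z) Y W' = 0" if "z \<notin> \<psi> ` Y"
      using that by (simp add: mat_def)
  qed
  finally show ?thesis .
qed

lemma convolution_ab_support: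
  assumes "convolution \<G> a b (x, h, x') \<noteq> 0"
  shows "(x, h, x') \<in> topspace T \<and> h = \<one>\<^bsub>G\<^esub>" and "\<phi> x = \<phi> x'" and "x \<in> \<Union>\<W>" and "x' \<in> \<Union>\<W>"
proof -
  let ?S = "{y. a (x, g, y) \<noteq> 0 \<and> b (y, inv\<^bsub>G\<^esub> g, x') \<noteq> 0}"
  have *: "convolution \<G> a b (x, h, x') = (if h = \<one>\<^bsub>G\<^esub> then
      (\<Sum>y\<in>?S. a (x, g, y) * b (y, inv\<^bsub>G\<^esub> g, x')) else 0)"
    using convolution_homogeneous[of a g b "inv\<^bsub>G\<^esub> g"] a_support b_support g by simp
  have h: "h = \<one>\<^bsub>G\<^esub>"
    using assms * by metis
  have "?S \<noteq> {}"
    using assms * by (metis (no_types, lifting) sum.empty)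
  then obtain y where y: "a (x, g, y) \<noteq> 0" "b (y, inv\<^bsub>G\<^esub> g, x') \<noteq> 0"
    by blast
  obtain W where W: "W \<in> \<W>" "x \<in> W" "\<phi> x = \<psi> y"
    using a_support'[OF y(1)] by metis
  obtain W' where W': "W' \<in> \<W>" "x' \<in> W'" "\<phi> x' = \<psi> y"
    using b_nonzero[OF y(2)] by metis
  show eq: "\<phi> x = \<phi> x'" and "x \<in> \<Union>\<W>" "x' \<in> \<Union>\<W>"
    using W W' by auto
  have F: "F x' = F x" "\<alpha> (r (F x)) x = \<alpha> (r (F x)) x'"
    using eq by (auto simp: \<phi>_def)
  have "x \<in> dom (r (F x))" "x' \<in> dom (r (F x))"
    using \<W>_point(4)[OF W(1,2)] \<W>_point(4)[OF W'(1,2)] W(2) W'(2) F(1) by auto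
  then have "(x, h, x') \<in> D UNIV (r (F x)) (r (F x)) UNIV"
    using F(2) \<W>_point(1)[OF W(1,2)] by (simp add: mem_D h)
  then show "(x, h, x') \<in> topspace T \<and> h = \<one>\<^bsub>G\<^esub>"
    using D_subset_topspace \<W>_point(1)[OF W(1,2)] h by blast
qed

lemma convolution_aba: "convolution \<G> (convolution \<G> a b) a = a"
proof
  fix \<gamma> :: "'x \<times> 'g \<times> 'x"
  obtain x h y where xy: "\<gamma> = (x, h, y)"
    by (metis surj_pair)
  let ?f = "convolution \<G> a b"
  let ?S = "{x'. ?f (x, \<one>\<^bsub>G\<^esub>, x') \<noteq> 0 \<and> a (x', g, y) \<noteq> 0}"
  have eq: "convolution \<G> ?f a (x, h, y) =
      (if h = g then (\<Sum>x'\<in>?S. ?f (x, \<one>\<^bsub>G\<^esub>, x') * a (x', g, y)) else 0)"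
    using convolution_homogeneous[of ?f "\<one>\<^bsub>G\<^esub>" a g] a_support convolution_ab_support(1) g by simp
  show "convolution \<G> ?f a \<gamma> = a \<gamma>"
  proof (cases "h = g \<and> (\<exists>W\<in>\<W>. \<exists>Y\<in>\<Y>. x \<in> W \<and> y \<in> Y \<and> \<phi> x = \<psi> y)")
    case True
    then obtain W Y where WY: "h = g" "W \<in> \<W>" "Y \<in> \<Y>" "x \<in> W" "y \<in> Y" "\<phi> x = \<psi> y"
      by blast
    define z where "z = \<phi> x"
    have "(\<Sum>x'\<in>?S. ?f (x, \<one>\<^bsub>G\<^esub>, x') * a (x', g, y)) =
        (\<Sum>W'\<in>\<W>. (\<Sum>Y\<in>\<Y>. mat z (W, Y) * N (mat z) Y W') * mat z (W', Y))"
    proof (rule sum_fibre_eq_sum_cells[OF finite_\<W> disjoint_\<W> inj_on_\<phi>])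
      show "?S \<subseteq> {x' \<in> \<Union>\<W>. \<phi> x' = z}"
        using convolution_ab_support(2,4) by (auto simp: z_def)
      fix W' assume W': "W' \<in> \<W>"
      show "(\<Sum>Y\<in>\<Y>. mat z (W, Y) * N (mat z) Y W') * mat z (W', Y) =
          (if x' \<in> ?S then ?f (x, \<one>\<^bsub>G\<^esub>, x') * a (x', g, y) else 0)"
        if x': "x' \<in> W'" "\<phi> x' = z" for x'
      proof -
        have "mat z (W', Y) = a (x', g, y)"
          using mat_eq[OF W' WY(3) x'(1) WY(5) x'(2)] WY(6) z_def by simp
        moreover have "?f (x, \<one>\<^bsub>G\<^esub>, x') = (\<Sum>Y\<in>\<Y>. mat z (W, Y) * N (mat z) Y W')"
          using convolution_ab[OF WY(2,4) W' x'(1)] x'(2) z_def by simp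
        ultimately show ?thesis
          by auto
      qed
      show "(\<Sum>Y\<in>\<Y>. mat z (W, Y) * N (mat z) Y W') * mat z (W', Y) = 0" if "z \<notin> \<phi> ` W'"
        using that by (simp add: mat_def)
    qed
    also have "\<dots> = mat z (W, Y)"
      using N[OF WY(2,3), of "mat z"] by (simp add: mat_mult_def)
    also have "\<dots> = a (x, g, y)"
      using mat_eq[OF WY(2,3,4,5)] WY(6) z_def by simp
    finally show ?thesis
      using eq WY(1) xy by simp
  next
    case False
    have "a (x, h, y) = 0"
    proof (rule ccontr)
      assume "a (x, h, y) \<noteq> 0"
      then show False
        using False a_support a_support' by metis
    qed
    moreover have S: "?S = {}" if "h = g"
    proof (rule ccontr)
      assume "?S \<noteq> {}"
      then obtain x' where x': "?f (x, \<one>\<^bsub>G\<^esub>, x') \<noteq> 0" "a (x', g, y) \<noteq> 0"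
        by blast
      obtain W where W: "W \<in> \<W>" "x \<in> W"
        using convolution_ab_support(3)[OF x'(1)] by blast
      obtain Y where "Y \<in> \<Y>" "y \<in> Y" "\<phi> x' = \<psi> y"
        using a_support'[OF x'(2)] by metis
      with W convolution_ab_support(2)[OF x'(1)] False that show False
        by auto
    qed
    moreover have "convolution \<G> ?f a (x, h, y) = 0"
      unfolding eq using S by (cases "h = g") (simp_all only: sum.empty simp_thms if_True if_False)
    ultimately show ?thesis
      by (simp only: xy)
  qed
qed

end

theorem theorem5p14:
  fixes X :: "'x topology"
    and P :: "('p, 'm) monoid_scheme"
    and G :: "('g, 'n) monoid_scheme"
    and \<iota> :: "'p \<Rightarrow> 'g"
    and act :: "'x \<Rightarrow> 'p \<Rightarrow> 'x option"
  assumes "von_neumann_regular TYPE('r::{ring, monoid_mult})"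
    and "monoid_cancel P" and "left_reversible P"
    and "group_of_fractions P G \<iota>"
    and "locally_compact_space X" and "Hausdorff_space X" and "totally_disconnected_space X"
    and "partial_local_homeo_action X P act" and "directed_action X P act"
    and "\<And>p. p \<in> carrier P \<Longrightarrow> openin X (act_dom X act p) \<and> closedin X (act_dom X act p)"
  shows "graded_regular (carrier G)
           (groupoid_algebra (dr_groupoid X P act G \<iota>) :: ('x \<times> 'g \<times> 'x \<Rightarrow> 'r) set)
           (convolution (dr_groupoid X P act G \<iota>))
           (cocycle_component (dr_groupoid X P act G \<iota>) dr_cocycle)"
proof -
  have Gr: "group G" and hom: "\<iota> \<in> hom P G" and inj: "inj_on \<iota> (carrier P)"
    using assms(4) by (auto simp: group_of_fractions_def)
  interpret dr_action X P act G \<iota>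
    using assms(6,8,9) Gr hom inj by (simp add: dr_action_def dr_action_axioms_def)
  have "\<exists>b\<in>groupoid_algebra \<G>. convolution \<G> (convolution \<G> a b) a = a"
    if g: "g \<in> carrier G" and a: "a \<in> cocycle_component \<G> dr_cocycle g"
    for g and a :: "'x \<times> 'g \<times> 'x \<Rightarrow> 'r"
  proof -
    let ?\<U> = "{U. compact_open_bisection \<G> U \<and> U \<subseteq> dr_cocycle -` {g}}"
    have span: "a \<in> left_span {char_fun U | U. U \<in> ?\<U>}"
      using a by (simp add: cocycle_component_def)
    have \<U>: "\<forall>U\<in>?\<U>. compactin T U \<and> openin T U"
      by (simp add: compact_open_bisection_def gtop_dr_groupoid)
    note pre = compact_open_preimage_of_span[OF Hausdorff_T span \<U>]
    obtain K where K: "compactin T K" "K \<subseteq> \<Union>?\<U>" "{\<gamma>. a \<gamma> \<noteq> 0} \<subseteq> K"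
      using pre(2) by (elim exE conjE)
    have K_deg: "fst (snd \<gamma>) = g" if "\<gamma> \<in> K" for \<gamma>
      using K(2) that by (auto simp: dr_cocycle_def split_def)
    have clopen: "closedin X (dom p)" if "p \<in> carrier P" for p
      using assms(10) that by blast
    from cell_decomposition[OF assms(5,7) clopen K(1) K_deg]
    obtain \<W> \<Y> :: "'x set set" and F F' :: "'x \<Rightarrow> ('p \<times> 'p) set" and r t :: "('p \<times> 'p) set \<Rightarrow> 'p"
      where fin: "finite \<W>" "pairwise disjnt \<W>" "finite \<Y>" "pairwise disjnt \<Y>"
        and cells: "\<forall>W\<in>\<W>. compactin X W \<and> openin X W \<and>
          (\<exists>E. r E \<in> carrier P \<and> t E \<in> carrier P \<and> quot (r E) (t E) = g \<and>
            (\<forall>x\<in>W. F x = E) \<and> W \<subseteq> dom (r E) \<and> inj_on (\<alpha> (r E)) W)"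
          "\<forall>Y\<in>\<Y>. compactin X Y \<and> openin X Y \<and>
          (\<exists>E. r E \<in> carrier P \<and> t E \<in> carrier P \<and> quot (r E) (t E) = g \<and>
            (\<forall>y\<in>Y. F' y = E) \<and> Y \<subseteq> dom (t E) \<and> inj_on (\<alpha> (t E)) Y)"
        and K_cells: "\<forall>x h y. (x, h, y) \<in> K \<longrightarrow>
          x \<in> \<Union>\<W> \<and> y \<in> \<Union>\<Y> \<and> F x = F' y \<and> \<alpha> (r (F x)) x = \<alpha> (t (F' y)) y" .
    have supp: "(x, h, y) \<in> topspace T \<and> h = g \<and>
        x \<in> \<Union>\<W> \<and> y \<in> \<Union>\<Y> \<and> F x = F' y \<and> \<alpha> (r (F x)) x = \<alpha> (t (F' y)) y"
      if "a (x, h, y) \<noteq> 0" for x h y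
    proof -
      have \<gamma>: "(x, h, y) \<in> K"
        using K(3) that by blast
      have "(x, h, y) \<in> topspace T" "h = g"
        using \<gamma> compactin_subset_topspace[OF K(1)] K_deg[OF \<gamma>] by auto
      then show ?thesis
        using K_cells[THEN spec, THEN spec, THEN spec, THEN mp, OF \<gamma>]
        by (elim conjE) (intro conjI)
    qed
    have "\<forall>M :: 'x set \<times> 'x set \<Rightarrow> 'r. \<exists>N. \<forall>W\<in>\<W>. \<forall>Y\<in>\<Y>.
        mat_mult \<W> (mat_mult \<Y> (\<lambda>i j. M (i, j)) N) (\<lambda>i j. M (i, j)) W Y = M (W, Y)"
    proof
      fix M :: "'x set \<times> 'x set \<Rightarrow> 'r"
      show "\<exists>N. \<forall>W\<in>\<W>. \<forall>Y\<in>\<Y>.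
          mat_mult \<W> (mat_mult \<Y> (\<lambda>i j. M (i, j)) N) (\<lambda>i j. M (i, j)) W Y = M (W, Y)"
        using mat_regular_of_von_neumann_regular[OF assms(1) fin(1,3), of "\<lambda>i j. M (i, j)"]
        unfolding mat_regular_def .
    qed
    from choice[OF this] obtain N where N: "\<forall>M :: 'x set \<times> 'x set \<Rightarrow> 'r. \<forall>W\<in>\<W>. \<forall>Y\<in>\<Y>.
        mat_mult \<W> (mat_mult \<Y> (\<lambda>i j. M (i, j)) (N M)) (\<lambda>i j. M (i, j)) W Y = M (W, Y)"
      by (elim exE)
    interpret dr_cells X P act G \<iota> g a \<W> \<Y> F F' r t N
      by unfold_locales (fact g fin bspec[OF cells(1)] bspec[OF cells(2)] supp pre(1,3)
          N[THEN spec, THEN bspec, THEN bspec])+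
    show ?thesis
      using b_in_groupoid_algebra convolution_aba by blast
  qed
  then show ?thesis
    unfolding graded_regular_def by blast
qed

end
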